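(* Let $\alpha_0>0$, $\lambda_0>0$, and let $u\in\mathcal E((0,\infty),L^2(S^2))$ satisfy $\|u\|_{L^2(\mathbb R^3)}=1$, $u_\lambda=0$ in $L^2(S^2)$ only for $\lambda=\lambda_0$ in $(0,\infty)$, and $1+\alpha_0\gamma(\langle\langle u,u\rangle\rangle,\lambda_0)=0$. For $\alpha>0$ let $H_\alpha=H_0+\alpha\langle\cdot,u\rangle u$ on $L^2(\mathbb R^3)$, where $H_0=-\Delta$, and let $\zeta_\alpha$ be the average time delay for the pair $(H_0,H_\alpha)$. For each fixed $h\in\mathbb R$, $$\lim_{\alpha\to\alpha_0}\kappa(\alpha)\,\zeta_\alpha(\lambda_h(\alpha))=\frac{2}{h^2+1}.$$
   Context: Inner products are linear in the first argument. $H_0$ is the self-adjoint realization of $-\Delta$ on $L^2(\mathbb R^3)$ with domain $\{v:|\xi|^2\hat v\in L^2\}$; $H_\alpha$ has the same domain. $S^2$ is the unit sphere in $\mathbb R^3$ with surface measure; $\langle\langle\cdot,\cdot\rangle\rangle$ and $|||\cdot|||$ are the inner product and norm of $L^2(S^2)$. The unitary $U:L^2(\mathbb R^3)\to L^2([0,\infty),L^2(S^2))$, $(Uv)_\lambda(\omega)=2^{-1/2}\lambda^{1/4}\hat v(\sqrt\lambda\,\omega)=:v_\lambda(\omega)$ ($\hat v$ the unitary Fourier transform), diagonalizes $H_0$ as multiplication by $\lambda$; vectors $v\in L^2(\mathbb R^3)$ are identified with $(v_\lambda)_\lambda$. The function $\langle\langle v,w\rangle\rangle:\mathbb R\to\mathbb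 C$ is $\langle\langle v_\lambda,w_\lambda\rangle\rangle$ for $\lambda>0$ and $0$ for $\lambda\le0$. $\mathcal E((0,\infty),L^2(S^2))$ is the space of strongly smooth $\lambda\mapsto v_\lambda\in L^2(S^2)$ on $(0,\infty)$ such that $v_\lambda$ and all its strong derivatives decrease rapidly as $\lambda\to\infty$ and as $\lambda\to0^+$, i.e. $\sup_{\lambda\ge1}\lambda^m|||v^{(k)}_\lambda|||<\infty$ and $\sup_{0<\lambda\le1}\lambda^{-m}|||v^{(k)}_\lambda|||<\infty$ for all integers $m,k\ge0$; then $\langle\langle v,w\rangle\rangle\in\mathcal S(\mathbb R)$ for $v,w$ in this space. For $f\in\mathcal S(\mathbb R)$, $\gamma(f,\lambda)=\lim_{\epsilon\to0^+}\int_{|x-\lambda|\ge\epsilon}\frac{f(x)}{x-\lambda}dx$. For $\lambda>0$: $G_1(\alpha,\lambda)=1+\alpha\gamma(\langle\langle u,u\rangle\rangle,\lambda)$, $G_2(\alpha,\lambda)=\alpha\pi|||u_\lambda|||^2$, $G=G_1+iG_2$. $G(\alpha,\lambda)\neq 0$ for $\alpha>0$, $\alpha\ne\alpha_0$, $\lambda>0$. Let $\phi_\lambda=u_\lambda/(\lambda-\lambda_0)$ for $\lambda\ne\lambda_0$, $\phi_{\lambda_0}=u'_{\lambda_0}$ (strong derivative), an eigenvector of $H_{\alpha_0}$ for $\lambda_0$. Let $J\subset(0,\infty)$ be an open interval containing $\alpha_0$ and $\alpha\mapsto\lambda(\alpha)\in(0,\infty)$ a $C^1$ function on $J$ with $\lambda(\alpha_0)=\lambda_0$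 and $G_1(\alpha,\lambda(\alpha))=0$ (these exist by the implicit function theorem). For $\alpha\in J$ put $\kappa(\alpha)=\pi|||u_{\lambda(\alpha)}|||^2/\|\phi\|^2$ and $\lambda_h(\alpha)=\lambda(\alpha)+h\kappa(\alpha)$ (positive for $\alpha$ near $\alpha_0$). For $\alpha>0$, $\alpha\ne\alpha_0$, the scattering matrix of $(H_0,H_\alpha)$ at energy $\lambda>0$ is $S^{(\alpha)}_\lambda=I-\frac{2\pi i\alpha}{G(\alpha,\lambda)}\langle\langle\cdot,u_\lambda\rangle\rangle u_\lambda$, so $\det S^{(\alpha)}_\lambda=\overline{G(\alpha,\lambda)}/G(\alpha,\lambda)=e^{-2\pi i\xi_\alpha(\lambda)}$ with $\xi_\alpha(\lambda)=\frac1\pi\arg G(\alpha,\lambda)$ (principal branch; Krein's spectral shift function). The average time delay at energy $\lambda$ is $\zeta_\alpha(\lambda)=\frac{d}{d\lambda}\arg(\det S^{(\alpha)}_\lambda)=-2\pi\xi_\alpha'(\lambda)$. Limits $\alpha\to\alpha_0$ are over $\alpha\ne\alpha_0$. *)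

theory Defs
  imports "HOL-Analysis.Analysis"
begin

text \<open>
  There is no type of square integrable functions modulo null sets in the libraries, so vectors of
  \<open>L\<^sup>2\<close> are represented by functions, and "equal" for vectors means equal almost everywhere.
\<close>

definition L2 :: "'a measure \<Rightarrow> ('a \<Rightarrow> complex) set" where
  "L2 M = {f \<in> borel_measurable M. integrable M (\<lambda>x. (cmod (f x))\<^sup>2)}"

definition L2_inner :: "'a measure \<Rightarrow> ('a \<Rightarrow> complex) \<Rightarrow> ('a \<Rightarrow> complex) \<Rightarrow> complex" where
  "L2_inner M f g = (LINT x|M. f x * cnj (g x))"

definition L2_norm :: "'a measure \<Rightarrow> ('a \<Rightarrow> complex) \<Rightarrow> real" where
  "L2_norm M f = sqrt (LINT x|M. (cmod (f x))\<^sup>2)"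

text \<open>
  Surface measure of the unit sphere as cone measure: a Borel set \<open>A\<close> of the sphere has measure
  three times the volume of the cone \<open>{r\<omega>. 0 < r \<le> 1, \<omega> \<in> A}\<close>.
\<close>

definition S2 :: "(real^3) measure" where
  "S2 = scale_measure 3
     (distr (restrict_space lborel (cball 0 1 - {0})) (restrict_space borel (sphere 0 1))
        (\<lambda>x. x /\<^sub>R norm x))"

text \<open>
  \<open>fourier_L2 u v\<close>: \<open>v\<close> is (a representative of) the unitary Fourier transform of \<open>u\<close>, i.e. the
  \<open>L\<^sup>2\<close>-limit of the Fourier integrals of the truncations of \<open>u\<close> to balls.
\<close>

definition fourier_L2 :: "(real^3 \<Rightarrow> complex) \<Rightarrow> (real^3 \<Rightarrow> complex) \<Rightarrow> bool" where
  "fourier_L2 u v \<longleftrightarrow> u \<in> L2 lborel \<and> v \<in> L2 lborel \<and>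
     ((\<lambda>R::real. \<integral>\<^sup>+ \<xi>. ennreal ((cmod (v \<xi> -
          of_real ((2 * pi) powr (- 3 / 2)) *
          (LINT x:cball 0 R|lborel. exp (- \<i> * of_real (x \<bullet> \<xi>)) * u x)))\<^sup>2) \<partial>lborel)
      \<longlongrightarrow> 0) at_top"

text \<open>
  \<open>spectral_rep u v\<close>: the family \<open>\<lambda> \<mapsto> v \<lambda>\<close> represents \<open>Uu\<close>. As an element of
  \<open>L\<^sup>2([0,\<infinity>), L\<^sup>2(S\<^sup>2))\<close>, \<open>Uu\<close> is determined only for almost every \<open>\<lambda>\<close>; membership of \<open>v\<close> in
  \<open>E_space\<close> below then fixes every \<open>v \<lambda>\<close>, \<open>\<lambda> > 0\<close>, as a vector of \<open>L\<^sup>2(S\<^sup>2)\<close>.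
\<close>

definition spectral_rep :: "(real^3 \<Rightarrow> complex) \<Rightarrow> (real \<Rightarrow> real^3 \<Rightarrow> complex) \<Rightarrow> bool" where
  "spectral_rep u v \<longleftrightarrow> (\<exists>uh. fourier_L2 u uh \<and>
     (AE l in lborel. 0 < l \<longrightarrow>
        (AE \<omega> in S2. v l \<omega> = of_real (l powr (1/4) / sqrt 2) * uh (sqrt l *\<^sub>R \<omega>))))"

definition has_strong_derivative ::
    "(real \<Rightarrow> real^3 \<Rightarrow> complex) \<Rightarrow> (real^3 \<Rightarrow> complex) \<Rightarrow> real \<Rightarrow> bool" where
  "has_strong_derivative v w l \<longleftrightarrow>
     ((\<lambda>t. L2_norm S2 (\<lambda>\<omega>. (v t \<omega> - v l \<omega>) / of_real (t - l) - w \<omega>)) \<longlongrightarrow> 0) (at l)"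

definition strong_deriv :: "(real \<Rightarrow> real^3 \<Rightarrow> complex) \<Rightarrow> real \<Rightarrow> real^3 \<Rightarrow> complex" where
  "strong_deriv v l = (SOME w. w \<in> L2 S2 \<and> has_strong_derivative v w l)"

text \<open>\<open>D k l\<close> is the \<open>k\<close>-th strong derivative of \<open>v\<close> at \<open>l\<close>.\<close>

definition E_space :: "(real \<Rightarrow> real^3 \<Rightarrow> complex) set" where
  "E_space = {v. \<exists>D. (\<forall>l>0. D 0 l = v l) \<and>
     (\<forall>k. \<forall>l>0. D k l \<in> L2 S2 \<and> has_strong_derivative (D k) (D (Suc k) l) l) \<and>
     (\<forall>(m::nat) (k::nat).
        bdd_above ((\<lambda>l. l ^ m * L2_norm S2 (D k l)) ` {1..}) \<and>
        bdd_above ((\<lambda>l. (1 / l) ^ m * L2_norm S2 (D k l)) ` {0<..1}))}"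

definition direct_integral_norm :: "(real \<Rightarrow> real^3 \<Rightarrow> complex) \<Rightarrow> real" where
  "direct_integral_norm v = sqrt (LINT l:{0<..}|lborel. (L2_norm S2 (v l))\<^sup>2)"

definition fiber_inner ::
    "(real \<Rightarrow> real^3 \<Rightarrow> complex) \<Rightarrow> (real \<Rightarrow> real^3 \<Rightarrow> complex) \<Rightarrow> real \<Rightarrow> complex" where
  "fiber_inner v w l = (if 0 < l then L2_inner S2 (v l) (w l) else 0)"

definition pv_gamma :: "(real \<Rightarrow> complex) \<Rightarrow> real \<Rightarrow> complex" where
  "pv_gamma f l = Lim (at_right 0)
     (\<lambda>\<epsilon>. LINT x:{x. \<epsilon> \<le> \<bar>x - l\<bar>}|lborel. f x / of_real (x - l))"

text \<open>
  In the following definitions \<open>u\<close> is the family of fibers \<open>u\<^sub>\<lambda>\<close>. \<open>G1\<close> takes complex values because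
  \<open>pv_gamma\<close> does; its imaginary part vanishes.
\<close>

definition G1 :: "(real \<Rightarrow> real^3 \<Rightarrow> complex) \<Rightarrow> real \<Rightarrow> real \<Rightarrow> complex" where
  "G1 u \<alpha> l = 1 + of_real \<alpha> * pv_gamma (fiber_inner u u) l"

definition G2 :: "(real \<Rightarrow> real^3 \<Rightarrow> complex) \<Rightarrow> real \<Rightarrow> real \<Rightarrow> real" where
  "G2 u \<alpha> l = \<alpha> * pi * (L2_norm S2 (u l))\<^sup>2"

definition G :: "(real \<Rightarrow> real^3 \<Rightarrow> complex) \<Rightarrow> real \<Rightarrow> real \<Rightarrow> complex" where
  "G u \<alpha> l = G1 u \<alpha> l + \<i> * of_real (G2 u \<alpha> l)"

definition phi :: "(real \<Rightarrow> real^3 \<Rightarrow> complex) \<Rightarrow> real \<Rightarrow> real \<Rightarrow> real^3 \<Rightarrow> complex" where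
  "phi u l0 l = (if l = l0 then strong_deriv u l0 else (\<lambda>\<omega>. u l \<omega> / of_real (l - l0)))"

definition kappa ::
    "(real \<Rightarrow> real^3 \<Rightarrow> complex) \<Rightarrow> real \<Rightarrow> (real \<Rightarrow> real) \<Rightarrow> real \<Rightarrow> real" where
  "kappa u l0 lam \<alpha> = pi * (L2_norm S2 (u (lam \<alpha>)))\<^sup>2 / (direct_integral_norm (phi u l0))\<^sup>2"

text \<open>
  The stationary formula for the scattering matrix, at energy \<open>l\<close>, of the pair
  \<open>H\<^sub>0 = - \<Delta>\<close>, \<open>H\<^sub>\<alpha> = H\<^sub>0 + \<alpha> \<langle>\<cdot>, u\<rangle> u\<close>, as an operator on \<open>L\<^sup>2(S\<^sup>2)\<close>.
\<close>

definition scattering_matrix ::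
    "(real \<Rightarrow> real^3 \<Rightarrow> complex) \<Rightarrow> real \<Rightarrow> real \<Rightarrow> (real^3 \<Rightarrow> complex) \<Rightarrow> (real^3 \<Rightarrow> complex)" where
  "scattering_matrix u \<alpha> l g =
     (\<lambda>\<omega>. g \<omega> - 2 * pi * \<i> * of_real \<alpha> / G u \<alpha> l * L2_inner S2 g (u l) * u l \<omega>)"

text \<open>
  Fredholm determinant, on \<open>L\<^sup>2(S\<^sup>2)\<close>, of an operator of the form identity plus
  \<open>K = \<langle>\<cdot>, a\<rangle> b\<close>: it is \<open>1 + tr K\<close>, and does not depend on the choice of \<open>a\<close>, \<open>b\<close>.
\<close>

definition fredholm_det :: "((real^3 \<Rightarrow> complex) \<Rightarrow> (real^3 \<Rightarrow> complex)) \<Rightarrow> complex" where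
  "fredholm_det T = (THE d. \<exists>a\<in>L2 S2. \<exists>b\<in>L2 S2.
     (\<forall>g\<in>L2 S2. AE \<omega> in S2. T g \<omega> = g \<omega> + L2_inner S2 g a * b \<omega>) \<and>
     d = 1 + L2_inner S2 b a)"

text \<open>
  The derivative of \<open>arg (det S\<^sub>\<lambda>)\<close> for a local branch \<open>\<theta>\<close> of the argument. The principal value of
  the argument of \<open>det S\<^sub>\<lambda> = cnj G / G\<close> would not do: it jumps where \<open>G\<^sub>1\<close> vanishes. A branch
  differentiable at \<open>l\<close> is unique near \<open>l\<close> up to a constant multiple of \<open>2\<pi>\<close>; \<open>-2 Arg G\<close> is one.
\<close>

definition avg_time_delay ::
    "(real \<Rightarrow> (real^3 \<Rightarrow> complex) \<Rightarrow> (real^3 \<Rightarrow> complex)) \<Rightarrow> real \<Rightarrow> real" where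
  "avg_time_delay S l = (THE z. \<exists>\<theta>. (\<forall>\<^sub>F m in nhds l. fredholm_det (S m) = cis (\<theta> m)) \<and>
     (\<theta> has_real_derivative z) (at l))"

end

theory Submission
  imports Defs "HOL-Probability.Sinc_Integral"
begin

text \<open>
  Write \<open>f(\<lambda>) = |||u\<^sub>\<lambda>|||\<^sup>2\<close>, \<open>F = \<gamma>(f, \<cdot>)\<close> and \<open>N = \<parallel>\<phi>\<parallel>\<^sup>2\<close>. Since \<open>det S\<^sub>\<lambda> = cnj G / G\<close>, the time
  delay is \<open>2 (G\<^sub>2 G\<^sub>1' - G\<^sub>1 G\<^sub>2') / |G|\<^sup>2\<close> with \<open>G\<^sub>1 = 1 + \<alpha> F\<close> and \<open>G\<^sub>2 = \<alpha> \<pi> f\<close>. The nonnegative function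
  \<open>f\<close> has a double zero at \<open>\<lambda>\<^sub>0\<close>, so differentiating under the principal value and integrating by parts
  gives \<open>F'(\<lambda>\<^sub>0) = \<integral> f(x) / (x - \<lambda>\<^sub>0)\<^sup>2 dx = N\<close>. At \<open>\<lambda>(\<alpha>) + h \<kappa>\<close>, where \<open>\<kappa> = \<pi> f(\<lambda>(\<alpha>)) / N\<close> is nonzero for
  \<open>\<alpha> \<noteq> \<alpha>\<^sub>0\<close>, the mean value theorem yields \<open>G\<^sub>1 / \<kappa> \<rightarrow> h \<alpha>\<^sub>0 N\<close>, \<open>G\<^sub>2 / \<kappa> \<rightarrow> \<alpha>\<^sub>0 N\<close>, \<open>G\<^sub>1' \<rightarrow> \<alpha>\<^sub>0 N\<close> and
  \<open>G\<^sub>2' \<rightarrow> 0\<close>.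
\<close>

section \<open>Square integrable functions\<close>

lemma borel_measurable_cnj [measurable (raw)]:
  "f \<in> borel_measurable M \<Longrightarrow> (\<lambda>x. cnj (f x)) \<in> borel_measurable M"
  by (rule borel_measurable_continuous_on[where f = cnj]) (intro continuous_intros)

lemma L2_measurable [measurable_dest]: "f \<in> L2 M \<Longrightarrow> f \<in> borel_measurable M"
  by (simp add: L2_def)

lemma L2_integrable_norm_square: "f \<in> L2 M \<Longrightarrow> integrable M (\<lambda>x. (cmod (f x))\<^sup>2)"
  by (simp add: L2_def)

lemma L2_integrable_mult:
  assumes "f \<in> L2 M" "g \<in> L2 M"
  shows "integrable M (\<lambda>x. f x * cnj (g x))"
proof (rule Bochner_Integration.integrable_bound)
  show "integrable M (\<lambda>x. (cmod (f x))\<^sup>2 + (cmod (g x))\<^sup>2)"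
    using assms by (simp add: L2_integrable_norm_square)
  show "(\<lambda>x. f x * cnj (g x)) \<in> borel_measurable M"
    using assms by (auto dest!: L2_measurable)
  have "2 * (cmod (f x) * cmod (g x)) \<le> (cmod (f x))\<^sup>2 + (cmod (g x))\<^sup>2" for x
    using sum_squares_bound[of "cmod (f x)" "cmod (g x)"] by simp
  moreover have "0 \<le> cmod (f x) * cmod (g x)" for x by simp
  ultimately have "norm (f x * cnj (g x)) \<le> norm ((cmod (f x))\<^sup>2 + (cmod (g x))\<^sup>2)" for x
    unfolding norm_mult complex_mod_cnj real_norm_def
    by (smt (verit, best))
  then show "AE x in M. norm (f x * cnj (g x)) \<le> norm ((cmod (f x))\<^sup>2 + (cmod (g x))\<^sup>2)" by simp
qed

lemma L2_scale: "f \<in> L2 M \<Longrightarrow> (\<lambda>x. c * f x) \<in> L2 M"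
  by (auto simp: L2_def norm_mult power_mult_distrib)

lemma L2_add:
  assumes "f \<in> L2 M" "g \<in> L2 M"
  shows "(\<lambda>x. f x + g x) \<in> L2 M"
proof -
  have [measurable]: "f \<in> borel_measurable M" "g \<in> borel_measurable M"
    using assms by (auto dest: L2_measurable)
  have "integrable M (\<lambda>x. (cmod (f x + g x))\<^sup>2)"
  proof (rule Bochner_Integration.integrable_bound)
    show "integrable M (\<lambda>x. 2 * (cmod (f x))\<^sup>2 + 2 * (cmod (g x))\<^sup>2)"
      using assms by (simp add: L2_integrable_norm_square)
    have "(cmod (f x + g x))\<^sup>2 \<le> 2 * (cmod (f x))\<^sup>2 + 2 * (cmod (g x))\<^sup>2" for x
    proof -
      have "(cmod (f x + g x))\<^sup>2 \<le> (cmod (f x) + cmod (g x))\<^sup>2"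
        by (intro power_mono norm_triangle_ineq) simp
      also have "\<dots> \<le> 2 * (cmod (f x))\<^sup>2 + 2 * (cmod (g x))\<^sup>2"
        using sum_squares_bound[of "cmod (f x)" "cmod (g x)"] by (simp add: power2_sum)
      finally show ?thesis .
    qed
    then show "AE x in M. norm ((cmod (f x + g x))\<^sup>2) \<le> norm (2 * (cmod (f x))\<^sup>2 + 2 * (cmod (g x))\<^sup>2)"
      by simp
  qed measurable
  then show ?thesis by (simp add: L2_def)
qed

lemma L2_diff:
  assumes "f \<in> L2 M" "g \<in> L2 M"
  shows "(\<lambda>x. f x - g x) \<in> L2 M"
  using L2_add[OF assms(1) L2_scale[OF assms(2), of "-1"]] by simp

lemma L2_divide: "f \<in> L2 M \<Longrightarrow> (\<lambda>x. f x / c) \<in> L2 M"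
  using L2_scale[of f M "1 / c"] by simp

lemma L2_norm_nonneg [simp]: "0 \<le> L2_norm M f"
  by (simp add: L2_norm_def)

lemma L2_norm_square: "(L2_norm M f)\<^sup>2 = (LINT x|M. (cmod (f x))\<^sup>2)"
  by (simp add: L2_norm_def)

lemma L2_inner_self: "L2_inner M f f = of_real ((L2_norm M f)\<^sup>2)"
  unfolding L2_inner_def L2_norm_square complex_norm_square[symmetric]
  by (rule integral_complex_of_real)

lemma L2_inner_diff_left:
  assumes "f \<in> L2 M" "g \<in> L2 M" "h \<in> L2 M"
  shows "L2_inner M (\<lambda>x. f x - g x) h = L2_inner M f h - L2_inner M g h"
  using assms by (simp add: L2_inner_def ring_distribs L2_integrable_mult)

lemma L2_inner_scale_left: "L2_inner M (\<lambda>x. c * f x) g = c * L2_inner M f g"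
  by (simp add: L2_inner_def mult.assoc)

lemma L2_inner_cnj: "L2_inner M g f = cnj (L2_inner M f g)"
proof -
  have "cnj (L2_inner M f g) = (LINT x|M. cnj (f x * cnj (g x)))"
    unfolding L2_inner_def by (rule Bochner_Integration.integral_cnj [symmetric])
  then show ?thesis by (simp add: L2_inner_def mult.commute)
qed

lemma L2_inner_diff_right:
  assumes "f \<in> L2 M" "g \<in> L2 M" "h \<in> L2 M"
  shows "L2_inner M h (\<lambda>x. f x - g x) = L2_inner M h f - L2_inner M h g"
  using assms by (simp add: L2_inner_def ring_distribs L2_integrable_mult)

lemma L2_norm_scale: "L2_norm M (\<lambda>x. c * f x) = cmod c * L2_norm M f"
  by (simp add: L2_norm_def norm_mult power_mult_distrib real_sqrt_mult)

lemma L2_norm_diff_square: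
  assumes "f \<in> L2 M" "g \<in> L2 M"
  shows "(L2_norm M (\<lambda>x. f x - g x))\<^sup>2
    = (L2_norm M f)\<^sup>2 + (L2_norm M g)\<^sup>2 - 2 * Re (L2_inner M f g)"
proof -
  have "complex_of_real ((L2_norm M (\<lambda>x. f x - g x))\<^sup>2)
      = L2_inner M f f - L2_inner M g f - (L2_inner M f g - L2_inner M g g)"
    using assms by (simp only: L2_inner_self [symmetric] L2_inner_diff_left L2_inner_diff_right L2_diff)
      simp
  also have "\<dots> = of_real ((L2_norm M f)\<^sup>2) + of_real ((L2_norm M g)\<^sup>2) - (L2_inner M f g + cnj (L2_inner M f g))"
    unfolding L2_inner_self L2_inner_cnj[of M g f] by simp
  also have "\<dots> = of_real ((L2_norm M f)\<^sup>2 + (L2_norm M g)\<^sup>2 - 2 * Re (L2_inner M f g))"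
    by (simp add: complex_add_cnj)
  finally show ?thesis by (simp only: of_real_eq_iff)
qed

text \<open>Expanding the squared norm of \<open>f - t z g\<close>, with \<open>z\<close> the inner
  product of \<open>f\<close> and \<open>g\<close>, gives a nonnegative real quadratic in
  \<open>t\<close>; since \<open>z\<close> sits in the coefficient, real \<open>t\<close> suffice.
  For \<open>b > 0\<close> take its minimum at \<open>t = 1 / b\<close>. For \<open>b = 0\<close> it
  is affine, and a nonzero slope would make it negative somewhere.\<close>

lemma L2_Cauchy_Schwarz:
  assumes "f \<in> L2 M" "g \<in> L2 M"
  shows "cmod (L2_inner M f g) \<le> L2_norm M f * L2_norm M g"
proof -
  define a where "a = (L2_norm M f)\<^sup>2"
  define b where "b = (L2_norm M g)\<^sup>2"
  define z where "z = L2_inner M f g"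
  have *: "0 \<le> a + t\<^sup>2 * (cmod z)\<^sup>2 * b - 2 * t * (cmod z)\<^sup>2" for t :: real
  proof -
    have "0 \<le> (L2_norm M (\<lambda>x. f x - (of_real t * z) * g x))\<^sup>2" by simp
    also have "\<dots> = a + (cmod (of_real t * z) * L2_norm M g)\<^sup>2 - 2 * Re (cnj (of_real t * z) * z)"
      using assms
      by (simp add: L2_norm_diff_square L2_scale L2_norm_scale a_def
          L2_inner_cnj[of M f "\<lambda>x. _ * g x"] L2_inner_scale_left L2_inner_cnj[of M g f] z_def
          flip: mult.assoc)
    also have "Re (cnj (of_real t * z) * z) = t * (cmod z)\<^sup>2"
      unfolding cmod_power2 by (simp add: power2_eq_square algebra_simps)
    finally show ?thesis by (simp add: norm_mult power_mult_distrib b_def)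
  qed
  have "(cmod z)\<^sup>2 \<le> a * b"
  proof (cases "b = 0")
    case True
    have "z = 0"
    proof (rule ccontr)
      assume "z \<noteq> 0"
      \<comment> \<open>This \<open>t\<close> sends the affine function to \<open>- a - 2\<close>,
        which is negative.\<close>
      then have "0 \<le> a - 2 * (a + 1)"
        using *[of "(a + 1) / (cmod z)\<^sup>2"] True by simp
      moreover have "0 \<le> a" by (simp add: a_def)
      ultimately show False by simp
    qed
    then show ?thesis using True by simp
  next
    case False
    then have b: "0 < b" by (simp add: b_def)
    then have "0 \<le> a - (cmod z)\<^sup>2 / b"
      using *[of "1 / b"] by (simp add: power2_eq_square)
    then show ?thesis using b by (simp add: field_simps)
  qed
  then have "(cmod z)\<^sup>2 \<le> (L2_norm M f * L2_norm M g)\<^sup>2" by (simp add: a_def b_def power_mult_distrib)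
  then show ?thesis unfolding z_def by (rule power2_le_imp_le) simp
qed

text \<open>Write \<open>f\<close> as \<open>(f - g) + g\<close> and estimate the cross term by
  Cauchy-Schwarz. In this form it bounds a difference quotient by its error plus the norm of the
  derivative.\<close>

lemma L2_norm_triangle:
  assumes "f \<in> L2 M" "g \<in> L2 M"
  shows "L2_norm M f \<le> L2_norm M (\<lambda>x. f x - g x) + L2_norm M g"
proof (rule power2_le_imp_le)
  let ?d = "\<lambda>x. f x - g x"
  have "- Re (L2_inner M ?d g) \<ge> - (L2_norm M ?d * L2_norm M g)"
    using L2_Cauchy_Schwarz[OF L2_diff[OF assms] assms(2)] complex_Re_le_cmod[of "L2_inner M ?d g"] by linarith
  moreover have "Re (L2_inner M ?d g) = Re (L2_inner M f g) - (L2_norm M g)\<^sup>2"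
    using assms by (simp add: L2_inner_diff_left L2_inner_self)
  ultimately show "(L2_norm M f)\<^sup>2 \<le> (L2_norm M ?d + L2_norm M g)\<^sup>2"
    unfolding power2_sum L2_norm_diff_square[OF assms] by simp
qed simp

lemma L2_inner_cong_AE:
  assumes "f \<in> L2 M" "f' \<in> L2 M" "g \<in> L2 M" "AE x in M. f x = f' x"
  shows "L2_inner M f g = L2_inner M f' g"
  unfolding L2_inner_def using assms
  by (intro integral_cong_AE) (auto dest!: L2_measurable)

section \<open>Strong derivatives and inner products of fiber families\<close>

text \<open>The difference quotient is within \<open>?e t\<close> of \<open>v'\<close>, so its norm
  stays bounded near \<open>l\<close>; the factor |t - l| then makes the increment vanish.\<close>

lemma strong_derivative_imp_continuous:
  assumes "\<And>t. 0 < t \<Longrightarrow> v t \<in> L2 S2" "v' \<in> L2 S2" "has_strong_derivative v v' l" "0 < l"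
  shows "((\<lambda>t. L2_norm S2 (\<lambda>\<omega>. v t \<omega> - v l \<omega>)) \<longlongrightarrow> 0) (at l)"
proof (rule Lim_null_comparison)
  let ?e = "\<lambda>t. L2_norm S2 (\<lambda>\<omega>. (v t \<omega> - v l \<omega>) / of_real (t - l) - v' \<omega>)"
  have "((\<lambda>t. (?e t + L2_norm S2 v') * \<bar>t - l\<bar>) \<longlongrightarrow> (0 + L2_norm S2 v') * \<bar>l - l\<bar>) (at l)"
    using assms(3) unfolding has_strong_derivative_def by (intro tendsto_intros)
  then show "((\<lambda>t. (?e t + L2_norm S2 v') * \<bar>t - l\<bar>) \<longlongrightarrow> 0) (at l)" by simp
  have "\<forall>\<^sub>F t in at l. 0 < t"
    using assms(4) by (rule order_tendstoD(1)[OF tendsto_ident_at])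
  moreover have "\<forall>\<^sub>F t in at l. t \<noteq> l"
    by (simp add: eventually_at_filter)
  ultimately show "\<forall>\<^sub>F t in at l. norm (L2_norm S2 (\<lambda>\<omega>. v t \<omega> - v l \<omega>)) \<le> (?e t + L2_norm S2 v') * \<bar>t - l\<bar>"
  proof eventually_elim
    case (elim t)
    let ?q = "\<lambda>\<omega>. (v t \<omega> - v l \<omega>) / of_real (t - l)"
    have "?q \<in> L2 S2" using assms elim by (intro L2_divide L2_diff) auto
    then have "L2_norm S2 ?q \<le> ?e t + L2_norm S2 v'"
      using assms(2) by (rule L2_norm_triangle)
    then have "L2_norm S2 ?q * \<bar>t - l\<bar> \<le> (?e t + L2_norm S2 v') * \<bar>t - l\<bar>"
      by (rule mult_right_mono) simp
    moreover have "L2_norm S2 (\<lambda>\<omega>. v t \<omega> - v l \<omega>) = L2_norm S2 (\<lambda>\<omega>. of_real (t - l) * ?q \<omega>)"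
      using elim by simp
    ultimately show ?case
      unfolding L2_norm_scale norm_of_real by (simp add: mult.commute)
  qed
qed

text \<open>Product rule. The error of the difference quotient splits into the pairings of
  \<open>?X\<close> with \<open>w t\<close>, of \<open>v'\<close> with \<open>?Y\<close> and of
  \<open>v l\<close> with \<open>?Z\<close>; Cauchy-Schwarz sends each to 0.\<close>

lemma has_derivative_L2_inner:
  assumes v: "\<And>t. 0 < t \<Longrightarrow> v t \<in> L2 S2" "v' \<in> L2 S2" "has_strong_derivative v v' l"
    and w: "\<And>t. 0 < t \<Longrightarrow> w t \<in> L2 S2" "w' \<in> L2 S2" "has_strong_derivative w w' l"
    and l: "0 < l"
  shows "((\<lambda>t. Re (L2_inner S2 (v t) (w t))) has_real_derivative
    Re (L2_inner S2 v' (w l)) + Re (L2_inner S2 (v l) w')) (at l)"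
  unfolding has_field_derivative_iff
proof (rule Lim_transform)
  let ?q = "\<lambda>v t \<omega>. (v t \<omega> - v l \<omega>) / of_real (t - l) :: complex"
  let ?c = "Re (L2_inner S2 v' (w l)) + Re (L2_inner S2 (v l) w')"
  show "((\<lambda>t. ?c) \<longlongrightarrow> ?c) (at l)" by simp
  let ?ev = "\<lambda>t. L2_norm S2 (\<lambda>\<omega>. ?q v t \<omega> - v' \<omega>)"
  let ?ew = "\<lambda>t. L2_norm S2 (\<lambda>\<omega>. ?q w t \<omega> - w' \<omega>)"
  let ?dw = "\<lambda>t. L2_norm S2 (\<lambda>\<omega>. w t \<omega> - w l \<omega>)"
  show "((\<lambda>t. (Re (L2_inner S2 (v t) (w t)) - Re (L2_inner S2 (v l) (w l))) / (t - l) - ?c) \<longlongrightarrow> 0) (at l)"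
  proof (rule Lim_null_comparison)
    \<comment> \<open>The norm of \<open>w t\<close> is replaced by \<open>?dw t\<close> plus the
      norm of \<open>w l\<close>, so that every factor has a known limit.\<close>
    let ?b = "\<lambda>t. ?ev t * (?dw t + L2_norm S2 (w l)) + L2_norm S2 v' * ?dw t + L2_norm S2 (v l) * ?ew t"
    have "(?b \<longlongrightarrow> 0 * (0 + L2_norm S2 (w l)) + L2_norm S2 v' * 0 + L2_norm S2 (v l) * 0) (at l)"
      using v(3) w(3) strong_derivative_imp_continuous[OF w l]
      unfolding has_strong_derivative_def by (intro tendsto_intros)
    then show "(?b \<longlongrightarrow> 0) (at l)" by simp
    have "\<forall>\<^sub>F t in at l. 0 < t"
      using l by (rule order_tendstoD(1)[OF tendsto_ident_at])
    moreover have "\<forall>\<^sub>F t in at l. t \<noteq> l"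
      by (simp add: eventually_at_filter)
    ultimately show "\<forall>\<^sub>F t in at l. norm ((Re (L2_inner S2 (v t) (w t)) - Re (L2_inner S2 (v l) (w l))) / (t - l) - ?c) \<le> ?b t"
    proof eventually_elim
      case (elim t)
      note mem = v(1)[OF elim(1)] v(1)[OF l] v(2) w(1)[OF elim(1)] w(1)[OF l] w(2)
      let ?X = "\<lambda>\<omega>. ?q v t \<omega> - v' \<omega>" and ?Y = "\<lambda>\<omega>. w t \<omega> - w l \<omega>" and ?Z = "\<lambda>\<omega>. ?q w t \<omega> - w' \<omega>"
      have mem2: "?q v t \<in> L2 S2" "?q w t \<in> L2 S2"
        using mem by (auto intro!: L2_divide L2_diff)
      have mem3: "?X \<in> L2 S2" "?Y \<in> L2 S2" "?Z \<in> L2 S2"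
        using mem mem2 by (auto intro!: L2_diff)
      have s: "L2_inner S2 (?q v t) g = (L2_inner S2 (v t) g - L2_inner S2 (v l) g) / of_real (t - l)"
        if "g \<in> L2 S2" for g
      proof -
        have "L2_inner S2 (?q v t) g = L2_inner S2 (\<lambda>\<omega>. (1 / of_real (t - l)) * (v t \<omega> - v l \<omega>)) g"
          by simp
        then show ?thesis using that mem
          by (simp only: L2_inner_scale_left L2_inner_diff_left) simp
      qed
      have s': "L2_inner S2 g (?q w t) = (L2_inner S2 g (w t) - L2_inner S2 g (w l)) / of_real (t - l)"
        if "g \<in> L2 S2" for g
      proof -
        have "L2_inner S2 (?q w t) g = L2_inner S2 (\<lambda>\<omega>. (1 / of_real (t - l)) * (w t \<omega> - w l \<omega>)) g"
          by simp
        also have "\<dots> = (L2_inner S2 (w t) g - L2_inner S2 (w l) g) / of_real (t - l)"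
          using that mem by (simp only: L2_inner_scale_left L2_inner_diff_left) simp
        finally have "cnj (L2_inner S2 (?q w t) g) = cnj \<dots>" by simp
        then show ?thesis by (simp add: L2_inner_cnj[of S2 g])
      qed
      have "L2_inner S2 ?X (w t) + L2_inner S2 v' ?Y + L2_inner S2 (v l) ?Z
          = (L2_inner S2 (v t) (w t) - L2_inner S2 (v l) (w l)) / of_real (t - l)
            - (L2_inner S2 v' (w l) + L2_inner S2 (v l) w')"
        using mem mem2 elim(2)
        by (simp only: L2_inner_diff_left L2_inner_diff_right s s')
          (simp add: diff_divide_distrib)
      then have "\<bar>(Re (L2_inner S2 (v t) (w t)) - Re (L2_inner S2 (v l) (w l))) / (t - l) - ?c\<bar>
          = \<bar>Re (L2_inner S2 ?X (w t) + L2_inner S2 v' ?Y + L2_inner S2 (v l) ?Z)\<bar>"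
        by (simp add: Re_divide_of_real)
      also have "\<dots> \<le> cmod (L2_inner S2 ?X (w t) + L2_inner S2 v' ?Y + L2_inner S2 (v l) ?Z)"
        by (rule abs_Re_le_cmod)
      also have "\<dots> \<le> cmod (L2_inner S2 ?X (w t)) + cmod (L2_inner S2 v' ?Y) + cmod (L2_inner S2 (v l) ?Z)"
        by (intro norm_triangle_mono order_refl)
      also have "\<dots> \<le> ?ev t * L2_norm S2 (w t) + L2_norm S2 v' * ?dw t + L2_norm S2 (v l) * ?ew t"
        using mem mem3 by (intro add_mono L2_Cauchy_Schwarz)
      also have "\<dots> \<le> ?b t"
        using mem by (intro add_mono order_refl mult_left_mono L2_norm_triangle L2_norm_nonneg)
      finally show ?case by simp
    qed
  qed
qed

section \<open>Determinants and time delay\<close>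

text \<open>
  Both presentations \<open>\<langle>\<cdot>, a\<rangle> b\<close> and \<open>\<langle>\<cdot>, a'\<rangle> b'\<close> are evaluated at \<open>b\<close> and \<open>b'\<close> and paired with
  \<open>a\<close> and \<open>a'\<close>; this gives \<open>x\<^sup>2 = y\<^sup>2 = z w\<close>, \<open>x z = z y\<close> and \<open>x w = w y\<close> for the four inner products.
\<close>

lemma rank_one_trace_unique:
  assumes mem: "a \<in> L2 M" "b \<in> L2 M" "a' \<in> L2 M" "b' \<in> L2 M"
    and eq: "\<And>g. g \<in> L2 M \<Longrightarrow> AE \<omega> in M. L2_inner M g a * b \<omega> = L2_inner M g a' * b' \<omega>"
  shows "L2_inner M b a = L2_inner M b' a'"
proof -
  define x y z w where "x = L2_inner M b a" "y = L2_inner M b' a'" "z = L2_inner M b a'"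
    "w = L2_inner M b' a"
  note d = this
  have *: "L2_inner M g a * L2_inner M b c = L2_inner M g a' * L2_inner M b' c"
    if "g \<in> L2 M" "c \<in> L2 M" for g c
    using L2_inner_cong_AE[OF L2_scale[OF mem(2)] L2_scale[OF mem(4)] that(2) eq[OF that(1)]]
    by (simp add: L2_inner_scale_left)
  have "x * x = z * w" "x * z = z * y" "w * x = y * w" "w * z = y * y"
    using *[of b a] *[of b a'] *[of b' a] *[of b' a'] mem unfolding d by auto
  \<comment> \<open>For \<open>z\<close> nonzero cancel it in \<open>x * z = z * y\<close>; for
    \<open>z = 0\<close> both squares are 0.\<close>
  then have "x = y" by (cases "z = 0") auto
  then show ?thesis by (simp add: d)
qed

text \<open>Two presentations of \<open>T\<close> minus the identity agree almost everywhere on each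
  vector, so \<open>rank_one_trace_unique\<close> gives them the same trace and the definite
  description denotes.\<close>

lemma fredholm_det_rank_one:
  assumes "a \<in> L2 S2" "b \<in> L2 S2"
    and T: "\<And>g. g \<in> L2 S2 \<Longrightarrow> AE \<omega> in S2. T g \<omega> = g \<omega> + L2_inner S2 g a * b \<omega>"
  shows "fredholm_det T = 1 + L2_inner S2 b a"
  unfolding fredholm_det_def
proof (rule the_equality)
  show "\<exists>a'\<in>L2 S2. \<exists>b'\<in>L2 S2. (\<forall>g\<in>L2 S2. AE \<omega> in S2. T g \<omega> = g \<omega> + L2_inner S2 g a' * b' \<omega>) \<and>
     1 + L2_inner S2 b a = 1 + L2_inner S2 b' a'"
    using assms by blast
next
  fix d
  assume "\<exists>a'\<in>L2 S2. \<exists>b'\<in>L2 S2. (\<forall>g\<in>L2 S2. AE \<omega> in S2. T g \<omega> = g \<omega> + L2_inner S2 g a' * b' \<omega>) \<and>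
     d = 1 + L2_inner S2 b' a'"
  then obtain a' b' where *: "a' \<in> L2 S2" "b' \<in> L2 S2"
    "\<And>g. g \<in> L2 S2 \<Longrightarrow> AE \<omega> in S2. T g \<omega> = g \<omega> + L2_inner S2 g a' * b' \<omega>"
    "d = 1 + L2_inner S2 b' a'" by blast
  have "AE \<omega> in S2. L2_inner S2 g a * b \<omega> = L2_inner S2 g a' * b' \<omega>" if "g \<in> L2 S2" for g
    using T[OF that] *(3)[OF that] by eventually_elim simp
  from rank_one_trace_unique[OF assms(1,2) *(1,2) this] show "d = 1 + L2_inner S2 b a"
    using *(4) by simp
qed

text \<open>The trace of the rank one part turns the determinant into
  \<open>(G - 2 i G2) / G\<close>. As \<open>G1\<close> is real, the numerator is the conjugate of
  \<open>G\<close>; as \<open>G2\<close> is nonzero, so is \<open>G\<close>.\<close>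

lemma fredholm_det_scattering_matrix:
  assumes u: "u l \<in> L2 S2" and G1: "G1 u \<alpha> l = of_real g" and G2: "G2 u \<alpha> l \<noteq> 0"
  shows "fredholm_det (scattering_matrix u \<alpha> l) = cnj (G u \<alpha> l) / G u \<alpha> l"
proof -
  have G: "G u \<alpha> l \<noteq> 0" using G1 G2 by (simp add: G_def complex_eq_iff)
  let ?c = "- (2 * pi * \<i> * of_real \<alpha> / G u \<alpha> l)"
  have "fredholm_det (scattering_matrix u \<alpha> l) = 1 + L2_inner S2 (\<lambda>\<omega>. ?c * u l \<omega>) (u l)"
    by (rule fredholm_det_rank_one[OF u L2_scale[OF u]])
       (simp add: scattering_matrix_def algebra_simps)
  also have "\<dots> = 1 + ?c * of_real ((L2_norm S2 (u l))\<^sup>2)"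
    by (simp only: L2_inner_scale_left L2_inner_self)
  also have "\<dots> = (G u \<alpha> l - 2 * \<i> * of_real (G2 u \<alpha> l)) / G u \<alpha> l"
    using G by (simp add: field_simps G2_def)
  also have "G u \<alpha> l - 2 * \<i> * of_real (G2 u \<alpha> l) = cnj (G u \<alpha> l)"
    using G1 by (simp add: G_def complex_eq_iff)
  finally show ?thesis .
qed

text \<open>In the upper half plane the argument of \<open>x + i y\<close> is
  \<open>pi / 2 - arctan (x / y)\<close>, and the quotient has minus twice that argument. This
  branch is smooth across \<open>x = 0\<close>, where the resonance sits.\<close>

lemma cnj_divide_eq_cis_arctan:
  fixes x y :: real
  assumes "0 < y"
  shows "cnj (Complex x y) / Complex x y = cis (2 * arctan (x / y) - pi)"
proof -
  define r where "r = x / y"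
  have x: "x = r * y" using assms by (simp add: r_def)
  have c: "cos (2 * arctan r) = (1 - r\<^sup>2) / (1 + r\<^sup>2)" "sin (2 * arctan r) = 2 * r / (1 + r\<^sup>2)"
  proof -
    have p: "0 < 1 + r\<^sup>2" by (simp add: add_pos_nonneg)
    then show "cos (2 * arctan r) = (1 - r\<^sup>2) / (1 + r\<^sup>2)"
      by (simp add: cos_double cos_arctan sin_arctan power_divide diff_divide_distrib)
    show "sin (2 * arctan r) = 2 * r / (1 + r\<^sup>2)"
      using p by (simp add: sin_double cos_arctan sin_arctan)
  qed
  have "cis (2 * arctan r - pi) = Complex (- ((1 - r\<^sup>2) / (1 + r\<^sup>2))) (- (2 * r / (1 + r\<^sup>2)))"
    by (simp add: complex_eq_iff c)
  moreover have "\<dots> * Complex x y = cnj (Complex x y)"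
  proof -
    have p: "1 + r\<^sup>2 \<noteq> 0" by (metis add_pos_nonneg less_numeral_extra(1) less_numeral_extra(3) zero_le_power2)
    show ?thesis using p unfolding x
      by (simp add: complex_eq_iff divide_simps) (simp add: power2_eq_square algebra_simps)
  qed
  moreover have "Complex x y \<noteq> 0" using assms by (simp add: complex_eq_iff)
  ultimately show ?thesis by (simp add: nonzero_divide_eq_eq flip: r_def)
qed

text \<open>Uniqueness: competing branches have the same \<open>cis\<close> near \<open>l\<close>.
  Differentiating it at \<open>l\<close> gives \<open>z\<close> and \<open>z'\<close> times the same
  nonzero number, so the branches themselves need not be compared near \<open>l\<close>.\<close>

lemma avg_time_delay_eqI:
  assumes "\<forall>\<^sub>F m in nhds l. fredholm_det (S m) = cis (\<theta> m)" "(\<theta> has_real_derivative z) (at l)"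
  shows "avg_time_delay S l = z"
  unfolding avg_time_delay_def
proof (rule the_equality)
  show "\<exists>\<theta>. (\<forall>\<^sub>F m in nhds l. fredholm_det (S m) = cis (\<theta> m)) \<and> (\<theta> has_real_derivative z) (at l)"
    using assms by blast
  fix z'
  assume "\<exists>\<theta>. (\<forall>\<^sub>F m in nhds l. fredholm_det (S m) = cis (\<theta> m)) \<and> (\<theta> has_real_derivative z') (at l)"
  then obtain \<theta>' where \<theta>': "\<forall>\<^sub>F m in nhds l. fredholm_det (S m) = cis (\<theta>' m)"
    "(\<theta>' has_real_derivative z') (at l)" by blast
  have ev: "\<forall>\<^sub>F m in nhds l. cis (\<theta> m) = cis (\<theta>' m)"
    using assms(1) \<theta>'(1) by eventually_elim simp
  have d: "((\<lambda>m. cis (\<theta> m)) has_vector_derivative z *\<^sub>R (\<i> * cis (\<theta> l))) (at l)"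
    if "(\<theta> has_real_derivative z) (at l)" for \<theta> z
    unfolding has_vector_derivative_def
    using has_derivative_cis[OF that[unfolded has_field_derivative_def]] by (simp add: mult.commute)
  have "((\<lambda>m. cis (\<theta>' m)) has_vector_derivative z *\<^sub>R (\<i> * cis (\<theta> l))) (at l)"
    by (rule has_vector_derivative_cong_ev[THEN iffD1, OF _ _ d[OF assms(2)]])
       (use ev eventually_nhds_x_imp_x[OF ev] in auto)
  from vector_derivative_unique_at[OF this d[OF \<theta>'(2)]]
  show "z' = z"
    using eventually_nhds_x_imp_x[OF ev] by (simp add: cis_neq_zero)
qed

section \<open>Principal value integrals\<close>

lemma integrable_inverse_one_plus_square: "integrable lborel (\<lambda>t::real. c / (1 + t\<^sup>2))"
proof -
  have "integrable lborel (\<lambda>t::real. inverse (1 + t\<^sup>2))"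
    using integrable_inverse_1_plus_square by (simp add: set_integrable_def)
  then have "integrable lborel (\<lambda>t::real. c * inverse (1 + t\<^sup>2))" by simp
  then show ?thesis by (simp add: divide_inverse)
qed

text \<open>A limit within \<open>S\<close> is tested on sequences in \<open>S - {a}\<close>, where
  sequential dominated convergence applies. The set \<open>S\<close> serves to restrict the
  parameter to a one-sided neighbourhood or to a ball with a uniform majorant.\<close>

lemma dominated_convergence_at_within:
  fixes s :: "real \<Rightarrow> 'a \<Rightarrow> 'b :: {banach, second_countable_topology}"
  assumes "integrable M w" "f \<in> borel_measurable M"
    and "\<And>x. x \<in> S - {a} \<Longrightarrow> s x \<in> borel_measurable M"
    and "\<And>x. x \<in> S - {a} \<Longrightarrow> AE t in M. norm (s x t) \<le> w t"
    and "AE t in M. ((\<lambda>x. s x t) \<longlongrightarrow> f t) (at a within S)"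
  shows "((\<lambda>x. integral\<^sup>L M (s x)) \<longlongrightarrow> integral\<^sup>L M f) (at a within S)"
  unfolding tendsto_at_iff_sequentially comp_def
proof (intro allI impI)
  fix X :: "nat \<Rightarrow> real"
  assume X: "\<forall>i. X i \<in> S - {a}" "X \<longlonglongrightarrow> a"
  show "(\<lambda>i. integral\<^sup>L M (s (X i))) \<longlonglongrightarrow> integral\<^sup>L M f"
  proof (rule integral_dominated_convergence[where w = w])
    show "AE t in M. (\<lambda>i. s (X i) t) \<longlonglongrightarrow> f t"
      using assms(5)
      by eventually_elim (use X in \<open>simp add: tendsto_at_iff_sequentially comp_def\<close>)
  qed (use X assms in auto)
qed

text \<open>The contributions of \<open>l + t\<close> and \<open>l - t\<close> are paired so that
  the singularity cancels. The quotient is even in \<open>t\<close>, so an integral over the whole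
  line counts each pair twice; hence the division by 2 in \<open>folded_pv\<close>.\<close>

definition symm_quot :: "(real \<Rightarrow> real) \<Rightarrow> real \<Rightarrow> real \<Rightarrow> real" where
  "symm_quot g l t = (g (l + t) - g (l - t)) / t"

text \<open>The principal value integral, folded about its singularity.\<close>

definition folded_pv :: "(real \<Rightarrow> real) \<Rightarrow> real \<Rightarrow> real" where
  "folded_pv g l = (LINT t|lborel. symm_quot g l t) / 2"

section \<open>Majorants for the folded integrand\<close>

lemma inverse_le_divideI:
  fixes x y k :: real
  assumes "0 < x" "0 < y" "y \<le> k * x"
  shows "1 / x \<le> k / y"
  using assms by (simp add: field_simps)

text \<open>A Peetre-type inequality: moving the decay weight from \<open>l + t\<close> to
  \<open>t\<close> costs a factor that depends on \<open>l\<close> alone.\<close>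

lemma one_plus_abs_mult_le: "1 + \<bar>t\<bar> \<le> (1 + \<bar>l + t\<bar>) * (1 + \<bar>l\<bar>)" for l t :: real
proof -
  have "1 + \<bar>t\<bar> \<le> 1 + \<bar>l + t\<bar> + \<bar>l\<bar>" by linarith
  also have "\<dots> \<le> (1 + \<bar>l + t\<bar>) * (1 + \<bar>l\<bar>)" by (simp add: algebra_simps)
  finally show ?thesis .
qed

lemma decay_translate:
  fixes g :: "real \<Rightarrow> real"
  assumes "\<And>x. \<bar>g x\<bar> \<le> C / (1 + \<bar>x\<bar>)"
  shows "\<bar>g (l + t)\<bar> \<le> C * (1 + \<bar>l\<bar>) / (1 + \<bar>t\<bar>)"
proof -
  have "0 \<le> C" using assms[of 0] by simp
  have "1 / (1 + \<bar>l + t\<bar>) \<le> (1 + \<bar>l\<bar>) / (1 + \<bar>t\<bar>)"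
    using one_plus_abs_mult_le[of t l] by (intro inverse_le_divideI) (simp_all add: mult.commute)
  from mult_left_mono[OF this \<open>0 \<le> C\<close>] show ?thesis
    using assms[of "l + t"] by simp
qed

text \<open>For |t| at most 1 the linear bound cancels the pole and 1 + t^2 is at most 2. For larger
  |t| the decay and the factor 1/|t| together give order t^(-2). Since \<open>M\<close> is at least
  1, one majorant serves both ranges.\<close>

lemma quotient_bound:
  fixes a t C M :: real
  assumes small: "\<bar>a\<bar> \<le> C * \<bar>t\<bar>" and large: "\<bar>a\<bar> \<le> C * M / (1 + \<bar>t\<bar>)" and C: "0 \<le> C" and M: "1 \<le> M"
  shows "\<bar>a / t\<bar> \<le> 2 * C * M / (1 + t\<^sup>2)"
proof (cases "t = 0")
  case True
  then show ?thesis using C M by simp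
next
  case False
  have p: "0 < 1 + t\<^sup>2" by (simp add: add_pos_nonneg)
  show ?thesis
  proof (cases "\<bar>t\<bar> \<le> 1")
    case True
    have "\<bar>a / t\<bar> \<le> C" using False small by (simp add: divide_simps)
    also have "C \<le> 2 * C * M / (1 + t\<^sup>2)"
    proof -
      have "t\<^sup>2 \<le> 1" using True by (simp add: abs_square_le_1)
      then have "C * (1 + t\<^sup>2) \<le> (C * M) * 2" using C M
        by (intro mult_mono) (auto simp: mult_le_cancel_left1)
      then show ?thesis using p by (simp add: divide_simps)
    qed
    finally show ?thesis .
  next
    case t: False
    have "\<bar>a / t\<bar> \<le> C * M / (1 + \<bar>t\<bar>) / \<bar>t\<bar>"
      unfolding abs_divide using large by (rule divide_right_mono) simp
    also have "\<dots> = C * M * (1 / ((1 + \<bar>t\<bar>) * \<bar>t\<bar>))" by simp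
    also have "\<dots> \<le> C * M * (2 / (1 + t\<^sup>2))"
    proof (rule mult_left_mono)
      have t2: "t\<^sup>2 = \<bar>t\<bar> * \<bar>t\<bar>" by (simp add: power2_eq_square)
      have "1 \<le> \<bar>t\<bar> * \<bar>t\<bar>" using t mult_mono[of 1 "\<bar>t\<bar>" 1 "\<bar>t\<bar>"] by simp
      then have "1 + t\<^sup>2 \<le> 2 * ((1 + \<bar>t\<bar>) * \<bar>t\<bar>)" unfolding t2 by (simp add: algebra_simps)
      moreover have "0 < (1 + \<bar>t\<bar>) * \<bar>t\<bar>" using False by (intro mult_pos_pos) auto
      ultimately show "1 / ((1 + \<bar>t\<bar>) * \<bar>t\<bar>) \<le> 2 / (1 + t\<^sup>2)"
        using p by (intro inverse_le_divideI)
    qed (use C M in simp)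
    finally show ?thesis by (simp add: mult_ac)
  qed
qed

text \<open>Two translates, at distance 2|t|, double both constants before
  \<open>quotient_bound\<close> is applied. The majorant is uniform for \<open>l\<close> in bounded
  sets, which permits dominated convergence in \<open>l\<close>.\<close>

lemma symm_quot_bound:
  assumes dec: "\<And>x. \<bar>g x\<bar> \<le> C / (1 + \<bar>x\<bar>)" and lip: "\<And>x y. \<bar>g x - g y\<bar> \<le> C * \<bar>x - y\<bar>"
  shows "\<bar>symm_quot g l t\<bar> \<le> 4 * C * (1 + \<bar>l\<bar>) / (1 + t\<^sup>2)"
proof -
  have "\<bar>g (l + t) - g (l - t)\<bar> \<le> 2 * C * (1 + \<bar>l\<bar>) / (1 + \<bar>t\<bar>)"
    using decay_translate[OF dec, of l t] decay_translate[OF dec, of l "- t"] by simp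
  moreover have "\<bar>g (l + t) - g (l - t)\<bar> \<le> 2 * C * \<bar>t\<bar>"
    using lip[of "l + t" "l - t"] by simp
  moreover have "0 \<le> C" using dec[of 0] by simp
  ultimately show ?thesis
    using quotient_bound[of "g (l + t) - g (l - t)" "2 * C" t "1 + \<bar>l\<bar>"] by (simp add: symm_quot_def)
qed

lemma symm_quot_measurable:
  assumes [measurable]: "g \<in> borel_measurable borel"
  shows "symm_quot g l \<in> borel_measurable borel"
  unfolding symm_quot_def by measurable

lemma symm_quot_integrable:
  assumes "\<And>x. \<bar>g x\<bar> \<le> C / (1 + \<bar>x\<bar>)" "\<And>x y. \<bar>g x - g y\<bar> \<le> C * \<bar>x - y\<bar>"
    "g \<in> borel_measurable borel"
  shows "integrable lborel (symm_quot g l)"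
proof (rule Bochner_Integration.integrable_bound[OF integrable_inverse_one_plus_square])
  show "AE t in lborel. norm (symm_quot g l t) \<le> norm (4 * C * (1 + \<bar>l\<bar>) / (1 + t\<^sup>2))"
    using order_trans[OF symm_quot_bound[OF assms(1,2)] abs_ge_self] by simp
qed (simp add: symm_quot_measurable assms(3))

text \<open>Shift the singularity to 0, then average the integral with its reflection under
  \<open>t\<close> to \<open>- t\<close>. Truncation makes both integrals absolutely convergent, so
  they may be added.\<close>

lemma truncated_pv_eq:
  assumes dec: "\<And>x. \<bar>g x\<bar> \<le> C / (1 + \<bar>x\<bar>)" and [measurable]: "g \<in> borel_measurable borel" and e: "0 < e"
  shows "(LINT x:{x. e \<le> \<bar>x - l\<bar>}|lborel. g x / (x - l))
    = (LINT t:{t. e \<le> \<bar>t\<bar>}|lborel. symm_quot g l t) / 2"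
proof -
  let ?i = "\<lambda>t. indicator {t. e \<le> \<bar>t\<bar>} t :: real"
  have C: "0 \<le> C" using dec[of 0] by simp
  have int: "integrable lborel (\<lambda>t. ?i t * (g (l + t) / t))"
  proof (rule Bochner_Integration.integrable_bound[OF integrable_inverse_one_plus_square])
    \<comment> \<open>On the truncated region |t|/e is at least 1; this absorbs the constant 1 of 1
      + t^2 and produces the factor \<open>1 + 1 / e\<close>.\<close>
    let ?K = "C * (1 + \<bar>l\<bar>) * (1 + 1 / e)"
    have "\<bar>?i t * (g (l + t) / t)\<bar> \<le> ?K / (1 + t\<^sup>2)" for t
    proof (cases "e \<le> \<bar>t\<bar>")
      case True
      then have t: "0 < \<bar>t\<bar>" using e by linarith
      have p: "0 < 1 + t\<^sup>2" by (simp add: add_pos_nonneg)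
      have "\<bar>g (l + t) / t\<bar> \<le> C * (1 + \<bar>l\<bar>) / (1 + \<bar>t\<bar>) / \<bar>t\<bar>"
        unfolding abs_divide by (intro divide_right_mono decay_translate dec) simp
      also have "\<dots> = C * (1 + \<bar>l\<bar>) * (1 / ((1 + \<bar>t\<bar>) * \<bar>t\<bar>))" by simp
      also have "\<dots> \<le> C * (1 + \<bar>l\<bar>) * ((1 + 1 / e) / (1 + t\<^sup>2))"
      proof (rule mult_left_mono)
        have "1 \<le> \<bar>t\<bar> / e" using True e by simp
        moreover have "0 \<le> t\<^sup>2 / e" using e by simp
        ultimately have "1 + t\<^sup>2 \<le> t\<^sup>2 + \<bar>t\<bar> + (t\<^sup>2 / e + \<bar>t\<bar> / e)" using t by linarith
        also have "\<dots> = (1 + 1 / e) * ((1 + \<bar>t\<bar>) * \<bar>t\<bar>)"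
          using e by (simp add: field_simps power2_eq_square)
        finally have le: "1 + t\<^sup>2 \<le> (1 + 1 / e) * ((1 + \<bar>t\<bar>) * \<bar>t\<bar>)" .
        have q: "0 < (1 + \<bar>t\<bar>) * \<bar>t\<bar>" using t by (intro mult_pos_pos) auto
        show "1 / ((1 + \<bar>t\<bar>) * \<bar>t\<bar>) \<le> (1 + 1 / e) / (1 + t\<^sup>2)"
          using le p q by (intro inverse_le_divideI)
      qed (use C in simp)
      finally show ?thesis using True by (simp add: mult.assoc)
    next
      case False
      have "0 \<le> ?K / (1 + t\<^sup>2)" using C e by (intro divide_nonneg_nonneg mult_nonneg_nonneg) auto
      then show ?thesis using False by simp
    qed
    then show "AE t in lborel. norm (?i t * (g (l + t) / t)) \<le> norm (?K / (1 + t\<^sup>2))"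
      unfolding real_norm_def using order_trans[OF _ abs_ge_self] by blast
  qed measurable
  have int': "integrable lborel (\<lambda>t. ?i t * (g (l - t) / (- t)))"
    using lborel_integrable_real_affine[OF int, of "-1" 0] by (simp add: indicator_def)
  have "(LINT x:{x. e \<le> \<bar>x - l\<bar>}|lborel. g x / (x - l))
      = (LINT t|lborel. ?i t * (g (l + t) / t))"
    unfolding set_lebesgue_integral_def
    by (subst lborel_integral_real_affine[where c = 1 and t = l]) (simp_all add: indicator_def)
  moreover have "(LINT t|lborel. ?i t * (g (l + t) / t)) = (LINT t|lborel. ?i t * (g (l - t) / (- t)))"
    by (subst lborel_integral_real_affine[where c = "-1" and t = 0]) (simp_all add: indicator_def)
  moreover have "(LINT t|lborel. ?i t * (g (l + t) / t)) + (LINT t|lborel. ?i t * (g (l - t) / (- t)))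
      = (LINT t:{t. e \<le> \<bar>t\<bar>}|lborel. symm_quot g l t)"
    unfolding set_lebesgue_integral_def Bochner_Integration.integral_add[OF int int', symmetric]
    by (rule Bochner_Integration.integral_cong) (simp_all add: symm_quot_def diff_divide_distrib algebra_simps)
  ultimately show ?thesis by linarith
qed

text \<open>After folding, the integrand is integrable across the singularity and dominates its own
  truncations. The truncated integrals therefore converge as \<open>e\<close> tends to 0, and
  \<open>Lim\<close> returns their limit.\<close>

lemma pv_gamma_eq_folded_pv:
  assumes dec: "\<And>x. \<bar>g x\<bar> \<le> C / (1 + \<bar>x\<bar>)" and lip: "\<And>x y. \<bar>g x - g y\<bar> \<le> C * \<bar>x - y\<bar>"
    and [measurable]: "g \<in> borel_measurable borel"
  shows "pv_gamma (\<lambda>x. complex_of_real (g x)) l = of_real (folded_pv g l)"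
  unfolding pv_gamma_def
proof (rule tendsto_Lim)
  let ?s = "\<lambda>e t. indicator {t. e \<le> \<bar>t\<bar>} t * symm_quot g l t"
  note [measurable] = symm_quot_measurable[OF assms(3)]
  have "((\<lambda>e. LINT t|lborel. ?s e t) \<longlongrightarrow> (LINT t|lborel. symm_quot g l t)) (at_right 0)"
  proof (rule dominated_convergence_at_within[where w = "\<lambda>t. \<bar>symm_quot g l t\<bar>"])
    show "integrable lborel (\<lambda>t. \<bar>symm_quot g l t\<bar>)"
      using symm_quot_integrable[OF assms] by simp
    show "AE t in lborel. ((\<lambda>e. ?s e t) \<longlongrightarrow> symm_quot g l t) (at_right 0)"
    proof (intro AE_I2)
      fix t :: real
      show "((\<lambda>e. ?s e t) \<longlongrightarrow> symm_quot g l t) (at_right 0)"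
      proof (cases "t = 0")
        case True
        \<comment> \<open>At \<open>t = 0\<close> the folded integrand is 0 by the convention for
          division by zero, in agreement with its truncations.\<close>
        then show ?thesis by (simp add: symm_quot_def)
      next
        case False
        have "\<forall>\<^sub>F e in at_right 0. e < \<bar>t\<bar>"
          using False by (intro eventually_at_right_real[THEN eventually_mono]) auto
        then have "\<forall>\<^sub>F e in at_right 0. ?s e t = symm_quot g l t"
          by eventually_elim simp
        then show ?thesis by (rule tendsto_eventually)
      qed
    qed
  qed (auto simp: indicator_def)
  then have lim: "((\<lambda>e. of_real ((LINT t|lborel. ?s e t) / 2)) \<longlongrightarrow> complex_of_real (folded_pv g l)) (at_right 0)"
    unfolding folded_pv_def by (intro tendsto_intros) auto
  have "\<forall>\<^sub>F e in at_right 0. (LINT x:{x. e \<le> \<bar>x - l\<bar>}|lborel. complex_of_real (g x) / of_real (x - l))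
      = of_real ((LINT t|lborel. ?s e t) / 2)"
    using eventually_at_right_less[of 0]
  proof eventually_elim
    case (elim e)
    have "(LINT x:{x. e \<le> \<bar>x - l\<bar>}|lborel. complex_of_real (g x) / of_real (x - l))
        = of_real (LINT x:{x. e \<le> \<bar>x - l\<bar>}|lborel. g x / (x - l))"
      unfolding set_lebesgue_integral_def integral_complex_of_real[symmetric]
      by (rule Bochner_Integration.integral_cong) (simp_all add: indicator_def)
    also have "\<dots> = of_real ((LINT t|lborel. ?s e t) / 2)"
      unfolding truncated_pv_eq[OF dec assms(3) elim] by (simp only: set_lebesgue_integral_def real_scaleR_def)
    finally show ?case .
  qed
  then show "((\<lambda>e. LINT x:{x. e \<le> \<bar>x - l\<bar>}|lborel. complex_of_real (g x) / of_real (x - l))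
      \<longlongrightarrow> of_real (folded_pv g l)) (at_right 0)"
    by (subst tendsto_cong) (use lim in auto)
qed simp

section \<open>Differentiation of the principal value\<close>

text \<open>Decay of order 1/|x| plus the factor 1/t of the kernel gives integrability at infinity.
  A Lipschitz bound on \<open>f'\<close> controls the folded integrand at 0 without asking for a
  second derivative at every point.\<close>

locale decaying_C1 =
  fixes f f' :: "real \<Rightarrow> real" and C :: real
  assumes deriv: "\<And>x. (f has_real_derivative f' x) (at x)"
    and decay: "\<And>x. \<bar>f x\<bar> \<le> C / (1 + \<bar>x\<bar>)"
    and decay': "\<And>x. \<bar>f' x\<bar> \<le> C / (1 + \<bar>x\<bar>)"
    and lipschitz': "\<And>x y. \<bar>f' x - f' y\<bar> \<le> C * \<bar>x - y\<bar>"
begin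

lemma C_nonneg: "0 \<le> C"
  using decay[of 0] by simp

lemma isCont_f: "isCont f x"
  using deriv by (rule DERIV_isCont)

lemma isCont_f': "isCont f' x"
  unfolding isCont_def
proof (rule LIM_zero_cancel, rule Lim_null_comparison)
  show "\<forall>\<^sub>F y in at x. norm (f' y - f' x) \<le> C * \<bar>y - x\<bar>"
    using lipschitz' by simp
  have "((\<lambda>y. C * \<bar>y - x\<bar>) \<longlongrightarrow> C * \<bar>x - x\<bar>) (at x)" by (intro tendsto_intros)
  then show "((\<lambda>y. C * \<bar>y - x\<bar>) \<longlongrightarrow> 0) (at x)" by simp
qed

lemma measurable_f: "f \<in> borel_measurable borel"
  by (intro borel_measurable_continuous_onI continuous_at_imp_continuous_on ballI isCont_f)

lemma measurable_f': "f' \<in> borel_measurable borel"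
  by (intro borel_measurable_continuous_onI continuous_at_imp_continuous_on ballI isCont_f')

lemma lipschitz: "\<bar>f x - f y\<bar> \<le> C * \<bar>x - y\<bar>"
proof -
  have "norm (f' z) \<le> C" for z
  proof -
    have "C / (1 + \<bar>z\<bar>) \<le> C" using C_nonneg by (simp add: divide_simps mult_le_cancel_left1)
    then show ?thesis using decay'[of z] by simp
  qed
  then show ?thesis
    using field_differentiable_bound[of UNIV f f' C x y] deriv by simp
qed

text \<open>Dominated convergence on the unit ball about \<open>l\<close>: there 1 + |x| is at most
  2 + |l|, whence the constant \<open>?K\<close>.\<close>

lemma folded_pv_isCont: "isCont (folded_pv f') l"
proof -
  let ?K = "4 * C * (2 + \<bar>l\<bar>)"
  have "((\<lambda>x. LINT t|lborel. symm_quot f' x t) \<longlongrightarrow> (LINT t|lborel. symm_quot f' l t)) (at l within ball l 1)"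
  proof (rule dominated_convergence_at_within[where w = "\<lambda>t. ?K / (1 + t\<^sup>2)"])
    show "AE t in lborel. norm (symm_quot f' x t) \<le> ?K / (1 + t\<^sup>2)" if "x \<in> ball l 1 - {l}" for x
    proof (intro AE_I2)
      fix t
      have "4 * C * (1 + \<bar>x\<bar>) / (1 + t\<^sup>2) \<le> ?K / (1 + t\<^sup>2)"
        using that C_nonneg by (intro divide_right_mono mult_left_mono) (auto simp: dist_real_def)
      then show "norm (symm_quot f' x t) \<le> ?K / (1 + t\<^sup>2)"
        using symm_quot_bound[OF decay' lipschitz', of x t] by simp
    qed
    show "AE t in lborel. ((\<lambda>x. symm_quot f' x t) \<longlongrightarrow> symm_quot f' l t) (at l within ball l 1)"
    proof (intro AE_I2)
      fix t
      have "((\<lambda>x. symm_quot f' x t) \<longlongrightarrow> symm_quot f' l t) (at l)"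
        unfolding symm_quot_def divide_inverse
        by (intro tendsto_intros isCont_tendsto_compose[OF isCont_f'])
      then show "((\<lambda>x. symm_quot f' x t) \<longlongrightarrow> symm_quot f' l t) (at l within ball l 1)"
        by (rule tendsto_within_subset) simp
    qed
  qed (auto intro: integrable_inverse_one_plus_square symm_quot_measurable measurable_f')
  then have "((\<lambda>x. LINT t|lborel. symm_quot f' x t) \<longlongrightarrow> (LINT t|lborel. symm_quot f' l t)) (at l)"
    by (simp add: at_within_open[of l "ball l 1"])
  then show ?thesis unfolding isCont_def folded_pv_def by (intro tendsto_intros) auto
qed

text \<open>After folding, the singularity stays at \<open>t = 0\<close> as \<open>l\<close> varies,
  so one may differentiate under the integral. The mean value inequality bounds the quotients in
  \<open>l\<close> by the majorant of \<open>symm_quot f'\<close>.\<close>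

lemma folded_pv_deriv: "(folded_pv f has_real_derivative folded_pv f' l) (at l)"
proof -
  let ?K = "4 * C * (2 + \<bar>l\<bar>)"
  let ?q = "\<lambda>x t. (symm_quot f x t - symm_quot f l t) / (x - l)"
  have dq: "((\<lambda>x. symm_quot f x t) has_real_derivative symm_quot f' x t) (at x)" for x t
    unfolding symm_quot_def divide_inverse
    by (auto intro!: derivative_eq_intros DERIV_chain2[OF deriv])
  have lim: "((\<lambda>x. LINT t|lborel. ?q x t) \<longlongrightarrow> (LINT t|lborel. symm_quot f' l t)) (at l within ball l 1)"
  proof (rule dominated_convergence_at_within[where w = "\<lambda>t. ?K / (1 + t\<^sup>2)"])
    show "AE t in lborel. norm (?q x t) \<le> ?K / (1 + t\<^sup>2)" if "x \<in> ball l 1 - {l}" for x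
    proof (intro AE_I2)
      fix t
      have "norm (symm_quot f x t - symm_quot f l t) \<le> ?K / (1 + t\<^sup>2) * norm (x - l)"
      proof (rule field_differentiable_bound[OF convex_ball])
        fix z assume "z \<in> ball l 1"
        then have "4 * C * (1 + \<bar>z\<bar>) / (1 + t\<^sup>2) \<le> ?K / (1 + t\<^sup>2)"
          using C_nonneg by (intro divide_right_mono mult_left_mono) (auto simp: dist_real_def)
        then show "norm (symm_quot f' z t) \<le> ?K / (1 + t\<^sup>2)"
          using symm_quot_bound[OF decay' lipschitz', of z t] by simp
      qed (use that dq in \<open>auto intro: has_field_derivative_at_within\<close>)
      then show "norm (?q x t) \<le> ?K / (1 + t\<^sup>2)"
        using that by (simp add: pos_divide_le_eq)
    qed
    show "AE t in lborel. ((\<lambda>x. ?q x t) \<longlongrightarrow> symm_quot f' l t) (at l within ball l 1)"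
    proof (intro AE_I2)
      fix t
      show "((\<lambda>x. ?q x t) \<longlongrightarrow> symm_quot f' l t) (at l within ball l 1)"
        using dq[of t l] unfolding has_field_derivative_iff
        by (rule tendsto_within_subset) simp
    qed
  qed (auto intro!: integrable_inverse_one_plus_square symm_quot_measurable measurable_f measurable_f'
      borel_measurable_divide borel_measurable_diff)
  have int: "integrable lborel (symm_quot f x)" for x
    by (rule symm_quot_integrable[OF decay lipschitz measurable_f])
  have "((\<lambda>x. (LINT t|lborel. ?q x t) / 2) \<longlongrightarrow> folded_pv f' l) (at l)"
    using lim unfolding folded_pv_def at_within_open[OF centre_in_ball[THEN iffD2, OF zero_less_one] open_ball]
    by (intro tendsto_divide tendsto_const) auto
  moreover have "(LINT t|lborel. ?q x t) / 2 = (folded_pv f x - folded_pv f l) / (x - l)" for x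
    by (simp add: folded_pv_def int flip: diff_divide_distrib)
  ultimately show ?thesis unfolding has_field_derivative_iff by simp
qed

text \<open>
  Integration by parts against \<open>1 / t\<close>: the boundary term \<open>f (l + t) / t\<close> vanishes at \<open>0\<close> because
  \<open>f\<close> has a double zero at \<open>l\<close>.
\<close>

lemma
  assumes zero: "f l = 0" "f' l = 0"
  shows integrable_double_pole: "integrable lborel (\<lambda>x. f x / (x - l)\<^sup>2)"
    and folded_pv_double_zero: "folded_pv f' l = (LINT x|lborel. f x / (x - l)\<^sup>2)"
proof -
  define r where "r = (\<lambda>t. f' (l + t) / t)"
  define q where "q = (\<lambda>t. f (l + t) / t)"
  define p where "p = (\<lambda>t. f (l + t) / t\<^sup>2)"
  \<comment> \<open>Off 0, \<open>k\<close> is the derivative of the boundary term \<open>q\<close>;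
    once its integral is shown to be 0, the integrals of \<open>r\<close> and \<open>p\<close>
    agree.\<close>
  define k where "k = (\<lambda>t. r t - p t)"
  note [measurable] = measurable_f measurable_f'
  have [measurable]: "r \<in> borel_measurable borel" "p \<in> borel_measurable borel"
    unfolding r_def p_def by measurable
  have f'_le: "\<bar>f' (l + t)\<bar> \<le> C * \<bar>t\<bar>" for t
    using lipschitz'[of "l + t" l] zero by simp
  \<comment> \<open>On the ball of radius |t| about \<open>l\<close> the derivative is at most C|t|,
    so the mean value inequality gives quadratic vanishing.\<close>
  have f_le: "\<bar>f (l + t)\<bar> \<le> C * t\<^sup>2" for t
  proof -
    have "norm (f (l + t) - f l) \<le> C * \<bar>t\<bar> * norm (l + t - l)"
    proof (rule field_differentiable_bound[of "cball l \<bar>t\<bar>"])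
      fix z assume "z \<in> cball l \<bar>t\<bar>"
      then have "C * \<bar>z - l\<bar> \<le> C * \<bar>t\<bar>"
        using C_nonneg by (intro mult_left_mono) (auto simp: dist_real_def)
      then show "norm (f' z) \<le> C * \<bar>t\<bar>" using f'_le[of "z - l"] by simp
    qed (auto intro: has_field_derivative_at_within deriv simp: dist_real_def)
    also have "\<dots> = C * t\<^sup>2" by (simp add: power2_eq_square)
    finally show ?thesis using zero by simp
  qed
  have q_le: "\<bar>q t\<bar> \<le> C * \<bar>t\<bar>" for t
  proof (cases "t = 0")
    case False
    then show ?thesis using f_le[of t] by (simp add: q_def divide_simps power2_eq_square)
  qed (simp add: q_def)
  have q_le': "\<bar>q t\<bar> \<le> 2 * C * (1 + \<bar>l\<bar>) / (1 + \<bar>t\<bar>)" for t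
  proof (cases "\<bar>t\<bar> \<le> 1")
    case True
    have "C * \<bar>t\<bar> * (1 + \<bar>t\<bar>) \<le> C * 1 * 2"
      using True C_nonneg by (intro mult_mono) auto
    also have "\<dots> \<le> 2 * C * (1 + \<bar>l\<bar>)" using C_nonneg by (simp add: algebra_simps)
    finally have "C * \<bar>t\<bar> \<le> 2 * C * (1 + \<bar>l\<bar>) / (1 + \<bar>t\<bar>)" by (simp add: pos_le_divide_eq)
    then show ?thesis using q_le[of t] by simp
  next
    case False
    have "\<bar>q t\<bar> \<le> \<bar>f (l + t)\<bar> / 1"
      unfolding q_def abs_divide using False by (intro divide_left_mono) auto
    also have "\<dots> \<le> C * (1 + \<bar>l\<bar>) / (1 + \<bar>t\<bar>)" using decay_translate[OF decay, of l t] by simp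
    also have "\<dots> \<le> 2 * C * (1 + \<bar>l\<bar>) / (1 + \<bar>t\<bar>)"
      using C_nonneg by (intro divide_right_mono mult_right_mono) auto
    finally show ?thesis .
  qed
  have r: "integrable lborel r"
  proof (rule Bochner_Integration.integrable_bound[OF integrable_inverse_one_plus_square])
    have "\<bar>r t\<bar> \<le> 2 * C * (1 + \<bar>l\<bar>) / (1 + t\<^sup>2)" for t
      unfolding r_def by (rule quotient_bound[OF f'_le decay_translate[OF decay'] C_nonneg]) simp
    from order_trans[OF this abs_ge_self]
    show "AE t in lborel. norm (r t) \<le> norm (2 * C * (1 + \<bar>l\<bar>) / (1 + t\<^sup>2))" by simp
  qed measurable
  \<comment> \<open>As \<open>p t\<close> is \<open>q t / t\<close>, the quotient estimate applies
    to \<open>q\<close>; the constant \<open>2 * C\<close> fits both its linear and its decaying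
    bound.\<close>
  have p: "integrable lborel p"
  proof (rule Bochner_Integration.integrable_bound[OF integrable_inverse_one_plus_square])
    have "\<bar>p t\<bar> \<le> 2 * (2 * C) * (1 + \<bar>l\<bar>) / (1 + t\<^sup>2)" for t
    proof -
      have "0 \<le> C * \<bar>t\<bar>" using C_nonneg by simp
      then have "\<bar>q t\<bar> \<le> 2 * C * \<bar>t\<bar>" using q_le[of t] by linarith
      then have "\<bar>q t / t\<bar> \<le> 2 * (2 * C) * (1 + \<bar>l\<bar>) / (1 + t\<^sup>2)"
        using C_nonneg by (intro quotient_bound q_le') auto
      then show ?thesis by (simp add: p_def q_def power2_eq_square)
    qed
    from order_trans[OF this abs_ge_self]
    show "AE t in lborel. norm (p t) \<le> norm (2 * (2 * C) * (1 + \<bar>l\<bar>) / (1 + t\<^sup>2))" by simp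
  qed measurable
  have k: "integrable lborel k" unfolding k_def using r p by simp
  have k': "integrable lborel (\<lambda>t. k (- t))"
    using lborel_integrable_real_affine[OF k, of "-1" 0] by simp
  have kk: "set_integrable lborel {0<..} (\<lambda>t. k t + k (- t))"
    unfolding set_integrable_def using k k'
    by (intro integrable_mult_indicator Bochner_Integration.integrable_add) auto

  have q_lim0: "((\<lambda>t. q t - q (- t)) \<longlongrightarrow> 0) (at_right 0)"
  proof (rule Lim_null_comparison)
    show "\<forall>\<^sub>F t in at_right 0. norm (q t - q (- t)) \<le> 2 * C * \<bar>t\<bar>"
    proof (rule always_eventually, rule allI)
      fix t show "norm (q t - q (- t)) \<le> 2 * C * \<bar>t\<bar>"
        using q_le[of t] q_le[of "- t"] by simp
    qed
    have "((\<lambda>t. 2 * C * \<bar>t\<bar>) \<longlongrightarrow> 2 * C * \<bar>0\<bar>) (at_right 0)" by (intro tendsto_intros)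
    then show "((\<lambda>t. 2 * C * \<bar>t\<bar>) \<longlongrightarrow> 0) (at_right 0)" by simp
  qed
  have q_lim_top: "((\<lambda>t. q t - q (- t)) \<longlongrightarrow> 0) at_top"
  proof (rule Lim_null_comparison)
    let ?K = "2 * (2 * C * (1 + \<bar>l\<bar>))"
    show "\<forall>\<^sub>F t in at_top. norm (q t - q (- t)) \<le> ?K / (1 + \<bar>t\<bar>)"
    proof (rule always_eventually, rule allI)
      fix t show "norm (q t - q (- t)) \<le> ?K / (1 + \<bar>t\<bar>)"
        using q_le'[of t] q_le'[of "- t"] by simp
    qed
    have "filterlim (\<lambda>t::real. 1 + \<bar>t\<bar>) at_top at_top"
      by (rule filterlim_at_top_mono[OF filterlim_ident]) (auto intro!: always_eventually)
    then show "((\<lambda>t. ?K / (1 + \<bar>t\<bar>)) \<longlongrightarrow> 0) at_top"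
      by (rule real_tendsto_divide_at_top[OF tendsto_const])
  qed
  have q_deriv: "(q has_real_derivative k t) (at t)" if "t \<noteq> 0" for t
    unfolding q_def k_def r_def p_def using that
    by (auto intro!: derivative_eq_intros DERIV_chain2[OF deriv] simp: field_simps power2_eq_square)
  have cont_k: "isCont k t" if "t \<noteq> 0" for t
    unfolding k_def r_def p_def using that
    by (intro continuous_intros isCont_o2[OF _ isCont_f] isCont_o2[OF _ isCont_f']) auto
  \<comment> \<open>Adding the reflection treats both half lines at once: the antiderivative
    \<open>q t - q (- t)\<close> vanishes at 0 by the double zero and at infinity by decay.\<close>
  have "(LBINT t=0..\<infinity>. k t + k (- t)) = 0 - 0"
  proof (rule interval_integral_FTC_integrable[where F = "\<lambda>t. q t - q (- t)"])
    fix t assume "0 < ereal t"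
    then have t: "t \<noteq> 0" by simp
    have "((\<lambda>t. q t - q (- t)) has_real_derivative k t + k (- t)) (at t)"
      using t by (auto intro!: derivative_eq_intros q_deriv DERIV_chain2[OF q_deriv])
    then show "((\<lambda>t. q t - q (- t)) has_vector_derivative k t + k (- t)) (at t)"
      by (simp add: has_real_derivative_iff_has_vector_derivative)
    show "isCont (\<lambda>t. k t + k (- t)) t"
      using t by (intro continuous_intros cont_k isCont_o2[OF _ cont_k]) auto
  next
    show "set_integrable lborel (einterval 0 \<infinity>) (\<lambda>t. k t + k (- t))"
      using kk by (simp add: zero_ereal_def)
    show "(((\<lambda>t. q t - q (- t)) \<circ> real_of_ereal) \<longlongrightarrow> 0) (at_right 0)"
      using q_lim0 by (simp add: zero_ereal_def ereal_tendsto_simps)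
    show "(((\<lambda>t. q t - q (- t)) \<circ> real_of_ereal) \<longlongrightarrow> 0) (at_left \<infinity>)"
      using q_lim_top by (simp add: ereal_tendsto_simps)
  qed simp
  then have "(LINT t:{0<..}|lborel. k t + k (- t)) = 0"
    by (simp add: zero_ereal_def interval_integral_to_infinity_eq)
  moreover have "(LINT t:{0<..}|lborel. k t + k (- t)) = (LINT t|lborel. k t)"
  proof -
    have "(LINT t:{0<..}|lborel. k t + k (- t))
        = (LINT t|lborel. indicator {0<..} t * k t) + (LINT t|lborel. indicator {0<..} t * k (- t))"
      unfolding set_lebesgue_integral_def
      using integrable_mult_indicator[OF _ k, of "{0<..}"] integrable_mult_indicator[OF _ k', of "{0<..}"]
      by (simp add: ring_distribs)
    also have "(LINT t|lborel. indicator {0<..} t * k (- t)) = (LINT t|lborel. indicator {..<0} t * k t)"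
      by (subst lborel_integral_real_affine[where c = "-1" and t = 0]) (simp_all add: indicator_def)
    also have "(LINT t|lborel. indicator {0<..} t * k t) + (LINT t|lborel. indicator {..<0} t * k t)
        = (LINT t|lborel. indicator {0<..} t * k t + indicator {..<0} t * k t)"
      using integrable_mult_indicator[OF _ k, of "{0<..}"] integrable_mult_indicator[OF _ k, of "{..<0}"]
      by simp
    also have "\<dots> = (LINT t|lborel. k t)"
    proof (rule integral_cong_AE)
      show "AE t in lborel. indicator {0<..} t * k t + indicator {..<0} t * k t = k t"
        using AE_lborel_singleton[of 0] by eventually_elim (auto simp: indicator_def)
    qed (use k in \<open>auto simp: k_def\<close>)
    finally show ?thesis .
  qed
  ultimately have rp: "(LINT t|lborel. r t) = (LINT t|lborel. p t)"
    using r p by (simp add: k_def)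
  have r': "integrable lborel (\<lambda>t. r (- t))" "(LINT t|lborel. r (- t)) = (LINT t|lborel. r t)"
    using lborel_integrable_real_affine[OF r, of "-1" 0] lborel_integral_real_affine[of "-1" r 0] by auto
  have "(LINT t|lborel. symm_quot f' l t) = (LINT t|lborel. r t + r (- t))"
    by (simp add: symm_quot_def r_def diff_divide_distrib)
  also have "\<dots> = 2 * (LINT t|lborel. p t)"
    using r r' rp by simp
  finally have pv: "folded_pv f' l = (LINT t|lborel. p t)"
    by (simp add: folded_pv_def)
  show "integrable lborel (\<lambda>x. f x / (x - l)\<^sup>2)"
    using lborel_integrable_real_affine[OF p, of 1 "- l"] by (simp add: p_def)
  show "folded_pv f' l = (LINT x|lborel. f x / (x - l)\<^sup>2)"
    unfolding pv by (subst lborel_integral_real_affine[of 1 _ "- l"]) (simp_all add: p_def)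
qed

end

section \<open>The resonance limit\<close>

text \<open>Base point and increment both move, so differentiability at \<open>c\<close> alone does
  not give the limit. The mean value theorem rewrites the quotient as \<open>h\<close> times
  \<open>g'\<close> at a point tending to \<open>c\<close>, where \<open>g'\<close> is continuous.
  The sign of \<open>h * k a\<close> is arbitrary, hence three cases.\<close>

lemma tendsto_difference_quotient_moving:
  fixes g g' :: "real \<Rightarrow> real"
  assumes deriv: "\<And>x. (g has_real_derivative g' x) (at x)" and cont: "isCont g' c"
    and b: "(b \<longlongrightarrow> c) A" and k: "(k \<longlongrightarrow> 0) A" and k0: "\<forall>\<^sub>F a in A. k a \<noteq> 0"
  shows "((\<lambda>a. (g (b a + h * k a) - g (b a)) / k a) \<longlongrightarrow> h * g' c) A"
proof -
  have mvt: "\<exists>\<xi>. \<bar>\<xi> - x\<bar> \<le> \<bar>d\<bar> \<and> g (x + d) - g x = d * g' \<xi>" for x d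
  proof (cases d "0 :: real" rule: linorder_cases)
    case equal
    then show ?thesis by auto
  next
    case greater
    then obtain z where "x < z" "z < x + d" "g (x + d) - g x = (x + d - x) * g' z"
      using MVT2[of x "x + d" g g'] deriv by auto
    then show ?thesis using greater by (intro exI[of _ z]) auto
  next
    case less
    then obtain z where "x + d < z" "z < x" "g x - g (x + d) = (x - (x + d)) * g' z"
      using MVT2[of "x + d" x g g'] deriv by auto
    then show ?thesis using less by (intro exI[of _ z]) auto
  qed
  have "\<exists>\<xi>. \<forall>a. \<bar>\<xi> a - b a\<bar> \<le> \<bar>h * k a\<bar> \<and> g (b a + h * k a) - g (b a) = h * k a * g' (\<xi> a)"
    using mvt by (intro choice allI)
  then obtain \<xi> where \<xi>: "\<And>a. \<bar>\<xi> a - b a\<bar> \<le> \<bar>h * k a\<bar>"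
    "\<And>a. g (b a + h * k a) - g (b a) = h * k a * g' (\<xi> a)" by blast
  have "((\<lambda>a. \<bar>h * k a\<bar>) \<longlongrightarrow> \<bar>h * 0\<bar>) A" using k by (intro tendsto_intros)
  then have "((\<lambda>a. \<bar>h * k a\<bar>) \<longlongrightarrow> 0) A" by simp
  moreover have "\<forall>\<^sub>F a in A. norm (\<xi> a - b a) \<le> \<bar>h * k a\<bar>"
    using \<xi>(1) by (intro always_eventually allI) (simp only: real_norm_def)
  ultimately have "((\<lambda>a. \<xi> a - b a) \<longlongrightarrow> 0) A" by (rule Lim_null_comparison[rotated])
  from tendsto_add[OF this b] have "(\<xi> \<longlongrightarrow> c) A" by simp
  then have "((\<lambda>a. g' (\<xi> a)) \<longlongrightarrow> g' c) A" by (rule isCont_tendsto_compose[OF cont])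
  then have lim: "((\<lambda>a. h * g' (\<xi> a)) \<longlongrightarrow> h * g' c) A" by (intro tendsto_intros)
  have "\<forall>\<^sub>F a in A. (g (b a + h * k a) - g (b a)) / k a = h * g' (\<xi> a)"
    using k0 by eventually_elim (simp add: \<xi>(2))
  from tendsto_cong[OF this] lim show ?thesis by blast
qed

text \<open>The numerator of the time delay is linear and its denominator quadratic in the pair of
  real and imaginary part of \<open>G\<close>, so the prefactor \<open>k\<close> amounts to dividing
  both parts by \<open>k\<close>. These quotients have finite limits that do not both
  vanish.\<close>

lemma breit_wigner_limit:
  fixes F F' f f' lam :: "real \<Rightarrow> real" and \<alpha>0 c N h :: real
  assumes dF: "\<And>x. (F has_real_derivative F' x) (at x)" "isCont F' c" "F' c = N"
    and df: "\<And>x. (f has_real_derivative f' x) (at x)" "isCont f' c" "f' c = 0" "f c = 0"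
    and pos: "0 < \<alpha>0" "0 < N" "0 < c"
    and lam: "(lam \<longlongrightarrow> c) (at \<alpha>0)"
    and f_pos: "\<forall>\<^sub>F \<alpha> in at \<alpha>0. 0 < f (lam \<alpha>)"
    and zero: "\<forall>\<^sub>F \<alpha> in at \<alpha>0. 1 + \<alpha> * F (lam \<alpha>) = 0"
  defines "k \<equiv> \<lambda>\<alpha>. pi * f (lam \<alpha>) / N"
  defines "p \<equiv> \<lambda>\<alpha>. lam \<alpha> + h * k \<alpha>"
  shows "\<forall>\<^sub>F \<alpha> in at \<alpha>0. 0 < p \<alpha> \<and> 0 < f (p \<alpha>)"
    and "((\<lambda>\<alpha>. k \<alpha> * (2 * (\<alpha> * pi * f (p \<alpha>) * (\<alpha> * F' (p \<alpha>)) - (1 + \<alpha> * F (p \<alpha>)) * (\<alpha> * pi * f' (p \<alpha>)))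
            / ((1 + \<alpha> * F (p \<alpha>))\<^sup>2 + (\<alpha> * pi * f (p \<alpha>))\<^sup>2))) \<longlongrightarrow> 2 / (h\<^sup>2 + 1)) (at \<alpha>0)"
proof -
  have "((\<lambda>\<alpha>. f (lam \<alpha>)) \<longlongrightarrow> f c) (at \<alpha>0)"
    by (rule isCont_tendsto_compose[OF DERIV_isCont[OF df(1)] lam])
  then have "(k \<longlongrightarrow> pi * f c / N) (at \<alpha>0)"
    unfolding k_def using pos by (intro tendsto_intros) auto
  then have k: "(k \<longlongrightarrow> 0) (at \<alpha>0)" using df by simp
  have k_pos: "\<forall>\<^sub>F \<alpha> in at \<alpha>0. 0 < k \<alpha>"
    using f_pos by eventually_elim (use pos in \<open>simp add: k_def\<close>)
  then have k0: "\<forall>\<^sub>F \<alpha> in at \<alpha>0. k \<alpha> \<noteq> 0" by eventually_elim simp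
  have "(p \<longlongrightarrow> c + h * 0) (at \<alpha>0)"
    unfolding p_def by (intro tendsto_intros lam k)
  then have p: "(p \<longlongrightarrow> c) (at \<alpha>0)" by simp
  \<comment> \<open>By the choice of \<open>k\<close>, the quotient of
    \<open>f (lam \<alpha>)\<close> by \<open>k \<alpha>\<close> is exactly \<open>N / pi\<close>;
    the increment from there contributes \<open>h * f' c = 0\<close>.\<close>
  have "((\<lambda>\<alpha>. N / pi + (f (p \<alpha>) - f (lam \<alpha>)) / k \<alpha>) \<longlongrightarrow> N / pi + h * f' c) (at \<alpha>0)"
    unfolding p_def by (intro tendsto_intros tendsto_difference_quotient_moving df lam k k0)
  moreover have "\<forall>\<^sub>F \<alpha> in at \<alpha>0. N / pi + (f (p \<alpha>) - f (lam \<alpha>)) / k \<alpha> = f (p \<alpha>) / k \<alpha>"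
    using f_pos by eventually_elim (use pos in \<open>simp add: k_def field_simps\<close>)
  ultimately have f_lim: "((\<lambda>\<alpha>. f (p \<alpha>) / k \<alpha>) \<longlongrightarrow> N / pi) (at \<alpha>0)"
    using df by (simp add: tendsto_cong)
  have 1: "((\<lambda>\<alpha>. \<alpha> * ((F (p \<alpha>) - F (lam \<alpha>)) / k \<alpha>)) \<longlongrightarrow> \<alpha>0 * (h * F' c)) (at \<alpha>0)"
    unfolding p_def by (intro tendsto_intros tendsto_difference_quotient_moving dF lam k k0)
  \<comment> \<open>Along the resonance curve \<open>\<alpha> * F (lam \<alpha>)\<close> equals -1,
    so the real part of \<open>G\<close> is itself an increment of
    \<open>\<alpha> * F\<close>.\<close>
  have "\<forall>\<^sub>F \<alpha> in at \<alpha>0. \<alpha> * ((F (p \<alpha>) - F (lam \<alpha>)) / k \<alpha>) = (1 + \<alpha> * F (p \<alpha>)) / k \<alpha>"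
    using zero
  proof eventually_elim
    case (elim \<alpha>)
    then have "\<alpha> * (F (p \<alpha>) - F (lam \<alpha>)) = 1 + \<alpha> * F (p \<alpha>)" by (simp add: algebra_simps)
    then show ?case by simp
  qed
  then have F_lim: "((\<lambda>\<alpha>. (1 + \<alpha> * F (p \<alpha>)) / k \<alpha>) \<longlongrightarrow> \<alpha>0 * (h * N)) (at \<alpha>0)"
    using iffD1[OF tendsto_cong 1] by (simp only: dF(3))
  have f'_lim: "((\<lambda>\<alpha>. f' (p \<alpha>)) \<longlongrightarrow> 0) (at \<alpha>0)"
    using isCont_tendsto_compose[OF df(2) p] df by simp
  have F'_lim: "((\<lambda>\<alpha>. F' (p \<alpha>)) \<longlongrightarrow> N) (at \<alpha>0)"
    using isCont_tendsto_compose[OF dF(2) p] dF by simp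

  \<comment> \<open>The limit \<open>N / pi\<close> is positive, which keeps the shifted energy away
    from the zero of \<open>f\<close>.\<close>
  have "\<forall>\<^sub>F \<alpha> in at \<alpha>0. 0 < f (p \<alpha>) / k \<alpha>"
    using pos by (intro order_tendstoD(1)[OF f_lim]) simp
  moreover have "\<forall>\<^sub>F \<alpha> in at \<alpha>0. 0 < p \<alpha>"
    using pos by (intro order_tendstoD(1)[OF p])
  ultimately show "\<forall>\<^sub>F \<alpha> in at \<alpha>0. 0 < p \<alpha> \<and> 0 < f (p \<alpha>)"
    using k_pos by eventually_elim (simp add: zero_less_divide_iff)

  let ?L = "\<lambda>\<alpha>. 2 * (\<alpha> * pi * (f (p \<alpha>) / k \<alpha>) * (\<alpha> * F' (p \<alpha>)) - (1 + \<alpha> * F (p \<alpha>)) / k \<alpha> * (\<alpha> * pi * f' (p \<alpha>)))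
      / (((1 + \<alpha> * F (p \<alpha>)) / k \<alpha>)\<^sup>2 + (\<alpha> * pi * (f (p \<alpha>) / k \<alpha>))\<^sup>2)"
  have nz: "(\<alpha>0 * (h * N))\<^sup>2 + (\<alpha>0 * pi * (N / pi))\<^sup>2 \<noteq> 0"
    using pos by (simp add: sum_power2_eq_zero_iff)
  have "(?L \<longlongrightarrow> 2 * (\<alpha>0 * pi * (N / pi) * (\<alpha>0 * N) - \<alpha>0 * (h * N) * (\<alpha>0 * pi * 0))
      / ((\<alpha>0 * (h * N))\<^sup>2 + (\<alpha>0 * pi * (N / pi))\<^sup>2)) (at \<alpha>0)"
    by (intro tendsto_intros f_lim F_lim f'_lim F'_lim nz)
  also have "2 * (\<alpha>0 * pi * (N / pi) * (\<alpha>0 * N) - \<alpha>0 * (h * N) * (\<alpha>0 * pi * 0))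
      / ((\<alpha>0 * (h * N))\<^sup>2 + (\<alpha>0 * pi * (N / pi))\<^sup>2) = 2 / (h\<^sup>2 + 1)"
  proof -
    have "2 * (\<alpha>0 * pi * (N / pi) * (\<alpha>0 * N) - \<alpha>0 * (h * N) * (\<alpha>0 * pi * 0)) = (\<alpha>0 * N)\<^sup>2 * 2"
      by (simp add: power2_eq_square)
    moreover have "(\<alpha>0 * (h * N))\<^sup>2 + (\<alpha>0 * pi * (N / pi))\<^sup>2 = (\<alpha>0 * N)\<^sup>2 * (h\<^sup>2 + 1)"
      by (simp add: power_mult_distrib algebra_simps)
    ultimately show ?thesis using pos by (simp only: mult_divide_mult_cancel_left_if) simp
  qed
  finally have lim: "(?L \<longlongrightarrow> 2 / (h\<^sup>2 + 1)) (at \<alpha>0)" .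
  have alg: "2 * (a / k * b - d / k * e) / ((d / k)\<^sup>2 + (a / k)\<^sup>2) = k * (2 * (a * b - d * e) / (d\<^sup>2 + a\<^sup>2))"
    if "k \<noteq> 0" for a b d e k :: real
  proof -
    have "2 * (a / k * b - d / k * e) = (2 * (a * b - d * e)) / k"
      by (simp add: diff_divide_distrib)
    moreover have "(d / k)\<^sup>2 + (a / k)\<^sup>2 = (d\<^sup>2 + a\<^sup>2) / k\<^sup>2"
      by (simp add: power_divide add_divide_distrib)
    ultimately show ?thesis using that by (simp add: power2_eq_square)
  qed
  have "\<forall>\<^sub>F \<alpha> in at \<alpha>0. ?L \<alpha> = k \<alpha> * (2 * (\<alpha> * pi * f (p \<alpha>) * (\<alpha> * F' (p \<alpha>)) - (1 + \<alpha> * F (p \<alpha>)) * (\<alpha> * pi * f' (p \<alpha>)))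
            / ((1 + \<alpha> * F (p \<alpha>))\<^sup>2 + (\<alpha> * pi * f (p \<alpha>))\<^sup>2))"
    using k0 by eventually_elim (simp only: alg times_divide_eq_right not_False_eq_True)
  from tendsto_cong[OF this] lim
  show "((\<lambda>\<alpha>. k \<alpha> * (2 * (\<alpha> * pi * f (p \<alpha>) * (\<alpha> * F' (p \<alpha>)) - (1 + \<alpha> * F (p \<alpha>)) * (\<alpha> * pi * f' (p \<alpha>)))
            / ((1 + \<alpha> * F (p \<alpha>))\<^sup>2 + (\<alpha> * pi * f (p \<alpha>))\<^sup>2))) \<longlongrightarrow> 2 / (h\<^sup>2 + 1)) (at \<alpha>0)"
    by blast
qed

section \<open>The time delay expressed through f and F\<close>

text \<open>Continuity keeps \<open>f\<close> positive near \<open>l\<close>, so the arctangent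
  branch represents the determinant on a whole neighbourhood; its derivative is then computed by the
  quotient and chain rules.\<close>

lemma avg_time_delay_scattering_matrix:
  assumes u: "\<And>m. 0 < m \<Longrightarrow> u m \<in> L2 S2" and l: "0 < l" and \<alpha>: "0 < \<alpha>"
    and G1: "\<And>m. 0 < m \<Longrightarrow> G1 u \<alpha> m = of_real (1 + \<alpha> * F m)"
    and f: "\<And>m. 0 < m \<Longrightarrow> (L2_norm S2 (u m))\<^sup>2 = f m"
    and dF: "(F has_real_derivative F') (at l)" and df: "(f has_real_derivative f') (at l)"
    and f_pos: "0 < f l"
  shows "avg_time_delay (scattering_matrix u \<alpha>) l
    = 2 * (\<alpha> * pi * f l * (\<alpha> * F') - (1 + \<alpha> * F l) * (\<alpha> * pi * f')) / ((1 + \<alpha> * F l)\<^sup>2 + (\<alpha> * pi * f l)\<^sup>2)"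
proof (rule avg_time_delay_eqI)
  let ?x = "\<lambda>m. 1 + \<alpha> * F m" and ?y = "\<lambda>m. \<alpha> * pi * f m"
  let ?\<theta> = "\<lambda>m. 2 * arctan (?x m / ?y m) - pi"
  have "\<forall>\<^sub>F m in nhds l. 0 < m"
    using eventually_nhds_in_open[of "{0<..}" l] l by simp
  moreover have "\<forall>\<^sub>F m in nhds l. 0 < f m"
    using DERIV_isCont[OF df] f_pos by (intro order_tendstoD(1)[of f "f l"]) (simp_all add: isCont_def tendsto_at_iff_tendsto_nhds)
  ultimately show "\<forall>\<^sub>F m in nhds l. fredholm_det (scattering_matrix u \<alpha> m) = cis (?\<theta> m)"
  proof eventually_elim
    case (elim m)
    then have y: "0 < ?y m" using \<alpha> by simp
    have G2: "G2 u \<alpha> m = ?y m" using f[OF elim(1)] by (simp add: G2_def)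
    have "G u \<alpha> m = Complex (?x m) (?y m)"
      unfolding G_def G1[OF elim(1)] G2 by (simp add: complex_eq_iff)
    moreover have "fredholm_det (scattering_matrix u \<alpha> m) = cnj (G u \<alpha> m) / G u \<alpha> m"
      by (rule fredholm_det_scattering_matrix[OF u[OF elim(1)] G1[OF elim(1)]]) (use y G2 in linarith)
    ultimately show ?case using cnj_divide_eq_cis_arctan[OF y] by simp
  qed
  have y: "?y l \<noteq> 0" using \<alpha> f_pos by simp
  have "(?\<theta> has_real_derivative 2 * ((?y l * (\<alpha> * F') - ?x l * (\<alpha> * pi * f')) / (?y l * ?y l) * inverse (1 + (?x l / ?y l)\<^sup>2))) (at l)"
    using y by (auto intro!: derivative_eq_intros dF df simp: mult_ac)
  also have "2 * ((?y l * (\<alpha> * F') - ?x l * (\<alpha> * pi * f')) / (?y l * ?y l) * inverse (1 + (?x l / ?y l)\<^sup>2))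
      = 2 * (?y l * (\<alpha> * F') - ?x l * (\<alpha> * pi * f')) / ((?x l)\<^sup>2 + (?y l)\<^sup>2)"
  proof -
    have "2 * (n / (y * y) * inverse (1 + (x / y)\<^sup>2)) = 2 * n / (x\<^sup>2 + y\<^sup>2)" if "y \<noteq> 0" for n x y :: real
    proof -
      have "1 + (x / y)\<^sup>2 = (x\<^sup>2 + y\<^sup>2) / (y * y)"
        using that by (simp add: power_divide add_divide_distrib power2_eq_square)
      then show ?thesis using that by simp
    qed
    from this[OF y] show ?thesis .
  qed
  finally show "(?\<theta> has_real_derivative 2 * (?y l * (\<alpha> * F') - ?x l * (\<alpha> * pi * f')) / ((?x l)\<^sup>2 + (?y l)\<^sup>2)) (at l)" .
qed

section \<open>Regularity of the squared fiber norm\<close>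

definition fiber_norm2 :: "(real \<Rightarrow> real^3 \<Rightarrow> complex) \<Rightarrow> real \<Rightarrow> real" where
  "fiber_norm2 u l = (if 0 < l then (L2_norm S2 (u l))\<^sup>2 else 0)"

lemma fiber_inner_self: "fiber_inner u u = (\<lambda>l. complex_of_real (fiber_norm2 u l))"
  by (auto simp: fiber_inner_def fiber_norm2_def L2_inner_self)

text \<open>For positive energies the product rule gives \<open>f'\<close> and a bounded second
  derivative. Decay of the fibers at 0 makes \<open>f\<close> and \<open>f'\<close> vanish there, so
  the extension by 0 to the left keeps a Lipschitz derivative.\<close>

lemma E_space_decaying_C1:
  assumes "u \<in> E_space"
  obtains f' C where "decaying_C1 (fiber_norm2 u) f' C"
proof -
  from assms obtain D where *: "(\<forall>l>0. D 0 l = u l) \<and>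
     (\<forall>k. \<forall>l>0. D k l \<in> L2 S2 \<and> has_strong_derivative (D k) (D (Suc k) l) l) \<and>
     (\<forall>(m::nat) (k::nat).
        bdd_above ((\<lambda>l. l ^ m * L2_norm S2 (D k l)) ` {1..}) \<and>
        bdd_above ((\<lambda>l. (1 / l) ^ m * L2_norm S2 (D k l)) ` {0<..1}))"
    unfolding E_space_def by (elim CollectE exE)
  then have D0: "\<And>l. 0 < l \<Longrightarrow> D 0 l = u l"
    and D: "\<And>k l. 0 < l \<Longrightarrow> D k l \<in> L2 S2" "\<And>k l. 0 < l \<Longrightarrow> has_strong_derivative (D k) (D (Suc k) l) l"
    by simp_all
  have bdd: "bdd_above ((\<lambda>l. l * L2_norm S2 (D k l)) ` {1..})"
      "bdd_above ((\<lambda>l. 1 / l * L2_norm S2 (D k l)) ` {0<..1})" for k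
    using conjunct2[OF conjunct2[OF *], rule_format, of 1 k] by simp_all
  let ?n = "\<lambda>k l. L2_norm S2 (D k l)"
  \<comment> \<open>First-order decay at 0 and at infinity, each known on its own side of 1,
    combines into three bounds valid for all positive \<open>l\<close>.\<close>
  have "\<exists>B\<ge>0. \<forall>l>0. ?n k l \<le> B \<and> ?n k l \<le> B * l \<and> l * ?n k l \<le> B" for k
  proof -
    obtain B1 B2 where B: "\<And>l. 1 \<le> l \<Longrightarrow> l * ?n k l \<le> B1" "\<And>l. 0 < l \<Longrightarrow> l \<le> 1 \<Longrightarrow> 1 / l * ?n k l \<le> B2"
      using bdd[of k] unfolding bdd_above_def by (simp add: image_iff) (metis atLeast_iff greaterThanAtMost_iff)
    define B where "B = max 0 (max B1 B2)"
    have "?n k l \<le> B \<and> ?n k l \<le> B * l \<and> l * ?n k l \<le> B" if l: "0 < l" for l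
    proof (cases "1 \<le> l")
      case True
      have 1: "l * ?n k l \<le> B" using B(1)[OF True] by (simp add: B_def)
      have "?n k l \<le> l * ?n k l" using mult_right_mono[OF True, of "?n k l"] by simp
      then have 2: "?n k l \<le> B" using 1 by simp
      have "0 \<le> B" by (simp add: B_def)
      then have "B \<le> B * l" using True by (simp add: mult_le_cancel_left1)
      then show ?thesis using 1 2 by simp
    next
      case False
      have "1 / l * ?n k l \<le> B" using B(2)[OF l] False by (simp add: B_def)
      then have 1: "?n k l \<le> B * l" using l by (simp add: field_simps)
      have "0 \<le> B" by (simp add: B_def)
      then have "B * l \<le> B" using False by (simp add: mult_le_cancel_left2)
      then have 2: "?n k l \<le> B" using 1 by simp
      have "l * ?n k l \<le> ?n k l" using mult_right_mono[of l 1 "?n k l"] False by simp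
      then show ?thesis using 1 2 by simp
    qed
    then show ?thesis by (intro exI[of _ B]) (auto simp: B_def)
  qed
  then obtain b where b: "\<And>k. 0 \<le> b k" "\<And>k l. 0 < l \<Longrightarrow> ?n k l \<le> b k"
      "\<And>k l. 0 < l \<Longrightarrow> ?n k l \<le> b k * l" "\<And>k l. 0 < l \<Longrightarrow> l * ?n k l \<le> b k"
    by metis
  define B where "B = b 0 + b 1 + b 2"
  have B0: "0 \<le> B" using b(1) by (simp add: B_def)
  have bB: "b k \<le> B" if "k \<in> {0, 1, 2}" for k
    using that b(1)[of 0] b(1)[of 1] b(1)[of 2] by (auto simp: B_def)
  have n_le: "?n k l \<le> B" "?n k l \<le> B * l" "?n k l \<le> 2 * B / (1 + l)" if "k \<in> {0, 1, 2}" "0 < l" for k l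
  proof -
    show 1: "?n k l \<le> B" using b(2)[OF that(2), of k] bB[OF that(1)] by simp
    show "?n k l \<le> B * l"
      using b(3)[OF that(2), of k] mult_right_mono[OF bB[OF that(1)], of l] that(2) by linarith
    have "l * ?n k l \<le> B" using b(4)[OF that(2), of k] bB[OF that(1)] by simp
    with 1 show "?n k l \<le> 2 * B / (1 + l)" using that(2) by (simp add: pos_le_divide_eq algebra_simps)
  qed
  \<comment> \<open>The estimates below give 2B^2/(1+x) for \<open>f\<close>, 4B^2/(1+x) for
    \<open>f'\<close> and 4B^2 for the second derivative; this constant covers all three.\<close>
  define C where "C = 4 * B\<^sup>2"
  define f where "f = fiber_norm2 u"
  define f' where "f' = (\<lambda>l. if 0 < l then 2 * Re (L2_inner S2 (D 1 l) (D 0 l)) else 0)"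
  have f_eq: "f l = (?n 0 l)\<^sup>2" if "0 < l" for l using that by (simp add: f_def fiber_norm2_def D0)
  have f_nonpos: "f l = 0" if "l \<le> 0" for l using that by (simp add: f_def fiber_norm2_def)
  have inner_le: "\<bar>Re (L2_inner S2 (D j l) (D k l))\<bar> \<le> ?n j l * ?n k l" if "0 < l" for j k l
    using L2_Cauchy_Schwarz[OF D(1)[OF that] D(1)[OF that]] abs_Re_le_cmod order_trans by blast
  have Re_inner_commute: "Re (L2_inner S2 v w) = Re (L2_inner S2 w v)" for v w
    using L2_inner_cnj[of S2 v w] by simp
  have prod_le: "\<bar>f' l\<bar> \<le> 2 * (B * X)" if "0 < l" "?n 0 l \<le> X" for l X
  proof -
    have "?n 1 l * ?n 0 l \<le> B * X"
      using that n_le(1)[of 1 l] B0 by (intro mult_mono) auto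
    then show ?thesis using inner_le[OF that(1), of 1 0] that(1) by (simp add: f'_def)
  qed
  have deriv_pos: "(f has_real_derivative f' l) (at l)" if l: "0 < l" for l
  proof -
    have "((\<lambda>t. Re (L2_inner S2 (D 0 t) (D 0 t))) has_real_derivative f' l) (at l)"
      using has_derivative_L2_inner[of "D 0" "D (Suc 0) l" l "D 0" "D (Suc 0) l"] D l
      by (simp add: f'_def Re_inner_commute[of "D 0 l"])
    then show ?thesis
      by (rule has_field_derivative_transform_within_open[of _ _ _ "{0<..}"])
        (use l in \<open>auto simp: f_eq L2_inner_self\<close>)
  qed
  have deriv_neg: "(f has_real_derivative 0) (at l)" if l: "l < 0" for l
    by (rule has_field_derivative_transform_within_open[of "\<lambda>_. 0" _ _ "{..<0}"])
      (use l in \<open>auto simp: f_nonpos\<close>)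
  \<comment> \<open>To the right of 0, \<open>f t\<close> is at most (Bt)^2, and to the left it is
    0.\<close>
  have deriv_0: "(f has_real_derivative 0) (at 0)"
    unfolding has_field_derivative_iff
  proof (rule Lim_null_comparison)
    have "\<bar>f t / t\<bar> \<le> B\<^sup>2 * \<bar>t\<bar>" for t
    proof (cases "0 < t")
      case True
      have "f t \<le> (B * t)\<^sup>2"
        unfolding f_eq[OF True] using n_le(2)[of 0 t] True by (intro power_mono) auto
      then have "f t / t \<le> B\<^sup>2 * t" using True by (simp add: field_simps power2_eq_square)
      moreover have "0 \<le> f t" using f_eq[OF True] by simp
      ultimately show ?thesis using True by simp
    qed (simp add: f_nonpos mult_nonneg_nonpos)
    then show "\<forall>\<^sub>F t in at 0. norm ((f t - f 0) / (t - 0)) \<le> B\<^sup>2 * \<bar>t\<bar>"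
      by (simp add: f_nonpos)
    have "((\<lambda>t. B\<^sup>2 * \<bar>t\<bar>) \<longlongrightarrow> B\<^sup>2 * \<bar>0\<bar>) (at 0)" by (intro tendsto_intros)
    then show "((\<lambda>t. B\<^sup>2 * \<bar>t\<bar>) \<longlongrightarrow> 0) (at 0)" by simp
  qed
  have C0: "0 \<le> C" by (simp add: C_def)
  have lip_pos: "\<bar>f' x - f' y\<bar> \<le> C * \<bar>x - y\<bar>" if "0 < x" "0 < y" for x y
  proof -
    let ?f'' = "\<lambda>l. 2 * (Re (L2_inner S2 (D 2 l) (D 0 l)) + Re (L2_inner S2 (D 1 l) (D 1 l)))"
    have "norm (f' x - f' y) \<le> C * norm (x - y)"
    proof (rule field_differentiable_bound[of "{0<..}" _ ?f''])
      fix l :: real assume "l \<in> {0<..}"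
      then have l: "0 < l" by simp
      have "((\<lambda>t. 2 * Re (L2_inner S2 (D 1 t) (D 0 t))) has_real_derivative ?f'' l) (at l)"
        using has_derivative_L2_inner[of "D 1" "D 2 l" l "D 0" "D 1 l"] D(1) D(2)[of l 1] D(2)[of l 0] l
        by (intro DERIV_cmult) (simp add: numeral_2_eq_2)
      then have "(f' has_real_derivative ?f'' l) (at l)"
        by (rule has_field_derivative_transform_within_open[of _ _ _ "{0<..}"])
          (use l in \<open>auto simp: f'_def\<close>)
      then show "(f' has_real_derivative ?f'' l) (at l within {0<..})"
        by (rule has_field_derivative_at_within)
      have "?n 2 l * ?n 0 l \<le> B * B" "?n 1 l * ?n 1 l \<le> B * B"
        using n_le(1)[of _ l] l B0 by (auto intro!: mult_mono)
      then show "norm (?f'' l) \<le> C"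
        using inner_le[OF l, of 2 0] inner_le[OF l, of 1 1] by (simp add: C_def power2_eq_square)
    qed (use that in auto)
    then show ?thesis by simp
  qed
  \<comment> \<open>For points on opposite sides of 0 the Lipschitz estimate goes through 0, where
    \<open>f'\<close> vanishes.\<close>
  have lip_0: "\<bar>f' y\<bar> \<le> C * y" if "0 < y" for y
  proof -
    have "\<bar>f' y\<bar> \<le> 2 * (B * (B * y))" using prod_le[OF that] n_le(2)[of 0 y] that by simp
    also have "\<dots> \<le> C * y" using that B0 by (simp add: C_def power2_eq_square)
    finally show ?thesis .
  qed
  have "decaying_C1 f f' C"
  proof
    fix x y :: real
    show "(f has_real_derivative f' x) (at x)"
      using deriv_pos deriv_neg deriv_0 by (cases x "0::real" rule: linorder_cases) (auto simp: f'_def)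
    show "\<bar>f x\<bar> \<le> C / (1 + \<bar>x\<bar>)"
    proof (cases "0 < x")
      case True
      have "?n 0 x * ?n 0 x \<le> B * (2 * B / (1 + x))"
        using n_le[of 0 x] True B0 by (intro mult_mono) auto
      also have "\<dots> \<le> C / (1 + x)"
        using True by (simp add: C_def power2_eq_square divide_right_mono)
      finally show ?thesis using True by (simp add: f_eq power2_eq_square)
    qed (use C0 f_nonpos in simp)
    show "\<bar>f' x\<bar> \<le> C / (1 + \<bar>x\<bar>)"
    proof (cases "0 < x")
      case True
      have "\<bar>f' x\<bar> \<le> 2 * (B * (2 * B / (1 + x)))"
        using prod_le[OF True n_le(3)[OF _ True]] by simp
      then show ?thesis using True by (simp add: C_def power2_eq_square)
    qed (use C0 in \<open>simp add: f'_def\<close>)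
    show "\<bar>f' x - f' y\<bar> \<le> C * \<bar>x - y\<bar>"
    proof -
      consider "0 < x" "0 < y" | "0 < x" "y \<le> 0" | "x \<le> 0" "0 < y" | "x \<le> 0" "y \<le> 0" by linarith
      then show ?thesis
      proof cases
        case 1
        then show ?thesis by (rule lip_pos)
      next
        case 2
        then have "C * x \<le> C * \<bar>x - y\<bar>" using C0 by (intro mult_left_mono) auto
        then show ?thesis using lip_0[OF 2(1)] 2 by (simp add: f'_def)
      next
        case 3
        then have "C * y \<le> C * \<bar>x - y\<bar>" using C0 by (intro mult_left_mono) auto
        then show ?thesis using lip_0[OF 3(2)] 3 by (simp add: f'_def)
      next
        case 4
        then show ?thesis using C0 by (simp add: f'_def)
      qed
    qed
  qed
  then show thesis using that by (simp add: f_def)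
qed

lemma E_space_L2: "u \<in> E_space \<Longrightarrow> 0 < l \<Longrightarrow> u l \<in> L2 S2"
  unfolding E_space_def by (elim CollectE exE conjE) metis

text \<open>Off \<open>l0\<close> the squared norm of the fiber is the double pole integrand, and a
  single point is a null set. This identifies the derivative of the principal value at
  \<open>l0\<close> with the squared norm of the eigenvector.\<close>

lemma direct_integral_norm_phi:
  assumes [measurable]: "fiber_norm2 u \<in> borel_measurable borel"
  shows "(direct_integral_norm (phi u l0))\<^sup>2 = (LINT x|lborel. fiber_norm2 u x / (x - l0)\<^sup>2)"
proof -
  let ?c = "indicator {0<..} l0 * (L2_norm S2 (strong_deriv u l0))\<^sup>2"
  have phi: "indicator {0<..} x *\<^sub>R (L2_norm S2 (phi u l0 x))\<^sup>2
      = (if x = l0 then ?c else fiber_norm2 u x / (x - l0)\<^sup>2)" for x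
  proof (cases "x = l0")
    case False
    have "L2_norm S2 (\<lambda>\<omega>. u x \<omega> / of_real (x - l0)) = L2_norm S2 (\<lambda>\<omega>. of_real (1 / (x - l0)) * u x \<omega>)"
      by simp
    also have "\<dots> = L2_norm S2 (u x) / \<bar>x - l0\<bar>"
      unfolding L2_norm_scale norm_of_real by simp
    finally show ?thesis using False
      by (simp add: phi_def fiber_norm2_def indicator_def power_divide)
  qed (simp add: phi_def)
  have "(LINT x:{0<..}|lborel. (L2_norm S2 (phi u l0 x))\<^sup>2) = (LINT x|lborel. fiber_norm2 u x / (x - l0)\<^sup>2)"
    unfolding set_lebesgue_integral_def phi
  proof (rule integral_cong_AE)
    show "AE x in lborel. (if x = l0 then ?c else fiber_norm2 u x / (x - l0)\<^sup>2) = fiber_norm2 u x / (x - l0)\<^sup>2"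
      using AE_lborel_singleton[of l0] by eventually_elim simp
  qed measurable
  moreover have "0 \<le> (LINT x:{0<..}|lborel. (L2_norm S2 (phi u l0 x))\<^sup>2)"
    unfolding set_lebesgue_integral_def by (intro Bochner_Integration.integral_nonneg) simp
  ultimately show ?thesis by (simp add: direct_integral_norm_def)
qed

theorem theorem7p8:
  fixes u :: "real^3 \<Rightarrow> complex" and u_fib :: "real \<Rightarrow> real^3 \<Rightarrow> complex"
    and \<alpha>0 l0 h :: real and J :: "real set" and lam :: "real \<Rightarrow> real"
  assumes "0 < \<alpha>0" and "0 < l0"
    and "spectral_rep u u_fib"
    and "u_fib \<in> E_space"
    and "L2_norm lborel u = 1"
    and "\<forall>l>0. L2_norm S2 (u_fib l) = 0 \<longleftrightarrow> l = l0"
    and "1 + of_real \<alpha>0 * pv_gamma (fiber_inner u_fib u_fib) l0 = 0"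
    and "open J" and "is_interval J" and "J \<subseteq> {0<..}" and "\<alpha>0 \<in> J"
    and "lam C1_differentiable_on J"
    and "lam ` J \<subseteq> {0<..}"
    and "lam \<alpha>0 = l0"
    and "\<forall>\<alpha>\<in>J. G1 u_fib \<alpha> (lam \<alpha>) = 0"
  shows "((\<lambda>\<alpha>. kappa u_fib l0 lam \<alpha> *
            avg_time_delay (scattering_matrix u_fib \<alpha>) (lam \<alpha> + h * kappa u_fib l0 lam \<alpha>))
          \<longlongrightarrow> 2 / (h\<^sup>2 + 1)) (at \<alpha>0)"
proof -
  define f where "f = fiber_norm2 u_fib"
  obtain f' C where "decaying_C1 f f' C"
    using E_space_decaying_C1[OF assms(4)] unfolding f_def by blast
  then interpret decaying_C1 f f' C .
  define F where "F = folded_pv f"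
  define F' where "F' = folded_pv f'"
  define N where "N = (LINT x|lborel. f x / (x - l0)\<^sup>2)"
  have f_eq: "(L2_norm S2 (u_fib l))\<^sup>2 = f l" if "0 < l" for l
    using that by (simp add: f_def fiber_norm2_def)
  have f_nonneg: "0 \<le> f l" for l by (simp add: f_def fiber_norm2_def)
  have f_zero_iff: "f l = 0 \<longleftrightarrow> l = l0" if "0 < l" for l
    using f_eq[OF that] assms(6) that by auto
  have f_l0: "f l0 = 0" using f_zero_iff assms(2) by simp
  \<comment> \<open>The nonnegative \<open>f\<close> attains its minimum 0 at \<open>l0\<close>;
    this makes the zero double.\<close>
  have f'_l0: "f' l0 = 0"
    using DERIV_local_min[OF deriv[of l0] zero_less_one] f_l0 f_nonneg by simp
  have gamma: "pv_gamma (fiber_inner u_fib u_fib) l = of_real (F l)" for l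
    unfolding fiber_inner_self F_def f_def[symmetric]
    by (rule pv_gamma_eq_folded_pv[OF decay lipschitz measurable_f])
  have G1: "G1 u_fib \<alpha> l = of_real (1 + \<alpha> * F l)" for \<alpha> l
    by (simp add: G1_def gamma)
  have N: "N = F' l0"
    unfolding N_def F'_def using folded_pv_double_zero[of l0] f_l0 f'_l0 by simp
  \<comment> \<open>A vanishing integral of a nonnegative function would force \<open>f\<close> to
    be 0 almost everywhere, but \<open>f\<close> is nonzero on the interval from \<open>l0\<close>
    to \<open>l0 + 1\<close>.\<close>
  have N_pos: "0 < N"
  proof -
    have int: "integrable lborel (\<lambda>x. f x / (x - l0)\<^sup>2)"
      by (rule integrable_double_pole[OF f_l0 f'_l0])
    have "N \<noteq> 0"
    proof
      assume "N = 0"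
      then have "AE x in lborel. f x / (x - l0)\<^sup>2 = 0"
        using integral_nonneg_eq_0_iff_AE[OF int] f_nonneg by (simp add: N_def)
      then have "AE x in lborel. x \<notin> {l0<..<l0 + 1}"
        by eventually_elim (use f_zero_iff assms(2) in auto)
      then have "emeasure lborel {l0<..<l0 + 1} = 0"
        by (subst (asm) AE_iff_measurable[of "{l0<..<l0 + 1}"]) auto
      then show False by simp
    qed
    moreover have "0 \<le> N" unfolding N_def using f_nonneg by (intro Bochner_Integration.integral_nonneg) simp
    ultimately show ?thesis by simp
  qed
  have J: "\<forall>\<^sub>F \<alpha> in at \<alpha>0. \<alpha> \<in> J \<and> \<alpha> \<noteq> \<alpha>0"
    using assms(8,11) by (auto simp: eventually_at_topological)
  have lam: "(lam \<longlongrightarrow> l0) (at \<alpha>0)"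
    using C1_differentiable_imp_continuous_on[OF assms(12)] assms(8,11,14)
    by (metis continuous_on_eq_continuous_at continuous_at)
  have lam_pos: "0 < lam \<alpha>" if "\<alpha> \<in> J" for \<alpha> using that assms(13) by auto
  have zero: "1 + \<alpha> * F (lam \<alpha>) = 0" if "\<alpha> \<in> J" for \<alpha>
    using assms(15) that unfolding G1 by (metis of_real_eq_0_iff)
  have f_pos: "0 < f (lam \<alpha>)" if "\<alpha> \<in> J" "\<alpha> \<noteq> \<alpha>0" for \<alpha>
  proof -
    \<comment> \<open>Otherwise \<open>\<alpha> * F l0\<close> and \<open>\<alpha>0 * F l0\<close>
      would both be -1, forcing \<open>\<alpha> = \<alpha>0\<close>.\<close>
    have "lam \<alpha> \<noteq> l0"
    proof
      assume "lam \<alpha> = l0"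
      then have "1 + \<alpha> * F l0 = 0" "1 + \<alpha>0 * F l0 = 0"
        using zero[OF that(1)] zero[OF assms(11)] assms(14) by simp_all
      then have "\<alpha> * F l0 = \<alpha>0 * F l0" by linarith
      moreover have "F l0 \<noteq> 0" using zero[OF assms(11)] assms(14) by auto
      ultimately show False using that(2) by simp
    qed
    then show ?thesis using f_zero_iff[OF lam_pos[OF that(1)]] f_nonneg[of "lam \<alpha>"] by simp
  qed
  define k where "k = (\<lambda>\<alpha>. pi * f (lam \<alpha>) / N)"
  have kappa: "kappa u_fib l0 lam \<alpha> = k \<alpha>" if "\<alpha> \<in> J" for \<alpha>
    using direct_integral_norm_phi[of u_fib l0] measurable_f f_eq[OF lam_pos[OF that]]
    by (simp add: kappa_def k_def N_def f_def)
  let ?p = "\<lambda>\<alpha>. lam \<alpha> + h * k \<alpha>"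
  let ?z = "\<lambda>\<alpha>. k \<alpha> * (2 * (\<alpha> * pi * f (?p \<alpha>) * (\<alpha> * F' (?p \<alpha>)) - (1 + \<alpha> * F (?p \<alpha>)) * (\<alpha> * pi * f' (?p \<alpha>)))
            / ((1 + \<alpha> * F (?p \<alpha>))\<^sup>2 + (\<alpha> * pi * f (?p \<alpha>))\<^sup>2))"
  have dF: "(F has_real_derivative F' x) (at x)" "isCont F' x" for x
    unfolding F_def F'_def by (rule folded_pv_deriv folded_pv_isCont)+
  have ev: "\<forall>\<^sub>F \<alpha> in at \<alpha>0. 0 < f (lam \<alpha>)" "\<forall>\<^sub>F \<alpha> in at \<alpha>0. 1 + \<alpha> * F (lam \<alpha>) = 0"
    using J by (auto elim!: eventually_mono intro: f_pos zero)
  have k_app: "pi * f (lam \<alpha>) / N = k \<alpha>" for \<alpha> by (simp add: k_def)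
  note lim = breit_wigner_limit[OF dF N[symmetric] deriv isCont_f' f'_l0 f_l0 assms(1) N_pos assms(2) lam ev,
      of h, unfolded k_app]
  \<comment> \<open>The explicit time delay holds where \<open>?p \<alpha>\<close> and
    \<open>f (?p \<alpha>)\<close> are positive, which \<open>lim(1)\<close> grants near
    \<open>\<alpha>0\<close>.\<close>
  have "\<forall>\<^sub>F \<alpha> in at \<alpha>0. kappa u_fib l0 lam \<alpha> *
      avg_time_delay (scattering_matrix u_fib \<alpha>) (lam \<alpha> + h * kappa u_fib l0 lam \<alpha>) = ?z \<alpha>"
    using J lim(1)
  proof eventually_elim
    case (elim \<alpha>)
    then have "0 < \<alpha>" using assms(10) by auto
    then show ?case
      unfolding kappa[OF conjunct1[OF elim(1)]]
      using elim(2) E_space_L2[OF assms(4)]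
      by (subst avg_time_delay_scattering_matrix[OF _ _ _ G1 f_eq dF(1) deriv]) auto
  qed
  from tendsto_cong[OF this] lim(2) show ?thesis by blast
qed

end
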